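(* For all integers $\alpha \geq 1$ and $n\geq 0$, \begin{align*} \mathfrak{B}_5\!\left(8\cdot5^{2\alpha}n+\frac{31\cdot 5^{2\alpha-1}+1}{3}\right)&\equiv 0\pmod 2,\\ \mathfrak{B}_5\!\left(8\cdot5^{2\alpha}n+\frac{79\cdot 5^{2\alpha-1}+1}{3}\right)&\equiv 0\pmod 2,\\ \mathfrak{B}_5\!\left(8\cdot5^{2\alpha+1}n+\frac{83\cdot 5^{2\alpha}+1}{3}\right)&\equiv 0\pmod 2,\\ \mathfrak{B}_5\!\left(8\cdot5^{2\alpha+1}n+\frac{107\cdot 5^{2\alpha}+1}{3}\right)&\equiv 0\pmod 2. \end{align*}
   Context: For $|q|<1$ write $(a;q)_\infty=\prod_{j=0}^{\infty}(1-aq^j)$. For an integer $k\geq 3$, $\mathfrak{B}_k(n)$ denotes the number of $k$ dots bracelet partitions of $n$; these integers are determined by the generating function \[ \sum_{n=0}^{\infty}\mathfrak{B}_{k}(n)q^n=\frac{(-q;q)_{\infty}}{(q;q)_{\infty}^{k-1}(-q^k;q^k)_{\infty}} . \] Here it is used with $k=5$. *)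

theory Defs
  imports "HOL-Complex_Analysis.Complex_Analysis" "HOL-Number_Theory.Cong"
begin

definition qpoch_inf :: "complex \<Rightarrow> complex \<Rightarrow> complex" where
  "qpoch_inf a q = (\<Prod>j. 1 - a * q ^ j)"

definition dots_bracelet_gf :: "nat \<Rightarrow> complex \<Rightarrow> complex" where
  "dots_bracelet_gf k q =
     qpoch_inf (- q) q / (qpoch_inf q q ^ (k - 1) * qpoch_inf (- (q ^ k)) (q ^ k))"

text \<open>
  The number of \<open>k\<close> dots bracelet partitions of \<open>n\<close>, as the \<open>n\<close>-th coefficient of its generating
  function. That the description below determines a unique integer sequence (for \<open>k \<ge> 3\<close>)
  is shown in \<open>dots_bracelet_unique_sequence\<close>.
\<close>
definition dots_bracelet :: "nat \<Rightarrow> nat \<Rightarrow> int" where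
  "dots_bracelet k = (THE B. \<forall>q. norm q < 1 \<longrightarrow>
     (\<lambda>n. of_int (B n) * q ^ n) sums dots_bracelet_gf k q)"

definition int_power_series :: "(complex \<Rightarrow> complex) \<Rightarrow> bool" where
  "int_power_series f \<longleftrightarrow>
     f holomorphic_on ball 0 1 \<and> (\<forall>n. fps_nth (fps_expansion f 0) n \<in> \<int>)"

lemma has_fps_expansion_imp_fps_expansion_eq:
  fixes f :: "complex \<Rightarrow> complex"
  assumes "f has_fps_expansion F"
  shows "fps_expansion f 0 = F"
  using assms by (auto simp: fps_eq_iff fps_nth_fps_expansion fps_expansion_def)

lemma int_power_seriesI:
  assumes "f holomorphic_on ball 0 1" "f has_fps_expansion F" "\<And>n. fps_nth F n \<in> \<int>"
  shows "int_power_series f"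
  using assms by (simp add: int_power_series_def has_fps_expansion_imp_fps_expansion_eq)

lemma int_power_series_expansion:
  assumes "int_power_series f"
  shows "f has_fps_expansion fps_expansion f 0"
  using assms unfolding int_power_series_def
  by (intro has_fps_expansion_fps_expansion[of "ball 0 1"]) auto

lemma fps_mult_Ints:
  fixes F G :: "complex fps"
  assumes "\<And>n. fps_nth F n \<in> \<int>" "\<And>n. fps_nth G n \<in> \<int>"
  shows "fps_nth (F * G) n \<in> \<int>"
  unfolding fps_mult_nth using assms by (intro Ints_sum Ints_mult)

lemma fps_one_minus_monom_Ints:
  "fps_nth (1 - fps_const (of_int s :: complex) * fps_X ^ M) n \<in> \<int>"
proof -
  have "fps_nth (fps_const (of_int s :: complex) * fps_X ^ M) n \<in> \<int>"
    by (subst fps_mult_left_const_nth, subst fps_X_power_nth) auto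
  moreover have "fps_nth (1 :: complex fps) n \<in> \<int>"
    by simp
  ultimately show ?thesis
    by (subst fps_sub_nth) (rule Ints_diff)
qed

lemma fps_inverse_Ints:
  fixes F :: "complex fps"
  assumes "\<And>n. fps_nth F n \<in> \<int>" "fps_nth F 0 = 1"
  shows "fps_nth (inverse F) n \<in> \<int>"
proof (induction n rule: less_induct)
  case (less n)
  show ?case
  proof (cases "n = 0")
    case True
    thus ?thesis using assms by simp
  next
    case False
    have "F * inverse F = 1"
      using assms(2) by (metis inverse_mult_eq_1' zero_neq_one)
    hence "0 = fps_nth (F * inverse F) n"
      using False by simp
    also have "\<dots> = (\<Sum>i=0..n. fps_nth F i * fps_nth (inverse F) (n - i))"
      by (simp add: fps_mult_nth)
    also have "\<dots> = fps_nth (inverse F) n + (\<Sum>i=Suc 0..n. fps_nth F i * fps_nth (inverse F) (n - i))"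
      using assms(2) by (subst sum.atLeast_Suc_atMost) auto
    finally have "fps_nth (inverse F) n =
        - (\<Sum>i=Suc 0..n. fps_nth F i * fps_nth (inverse F) (n - i))"
      by (simp add: eq_neg_iff_add_eq_0)
    moreover have "(\<Sum>i=Suc 0..n. fps_nth F i * fps_nth (inverse F) (n - i)) \<in> \<int>"
      using assms(1) less by (intro Ints_sum Ints_mult) auto
    ultimately show ?thesis by simp
  qed
qed

lemma int_power_series_const_1: "int_power_series (\<lambda>_. 1)"
  by (rule int_power_seriesI[where F = 1]) (auto simp: has_fps_expansion_1)

lemma int_power_series_mult:
  assumes "int_power_series f" "int_power_series g"
  shows "int_power_series (\<lambda>q. f q * g q)"
proof (rule int_power_seriesI)
  show "(\<lambda>q. f q * g q) has_fps_expansion fps_expansion f 0 * fps_expansion g 0"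
    using assms by (intro has_fps_expansion_mult int_power_series_expansion)
  show "(\<lambda>q. f q * g q) holomorphic_on ball 0 1"
    using assms by (intro holomorphic_intros) (auto simp: int_power_series_def)
qed (use assms in \<open>auto intro!: fps_mult_Ints simp: int_power_series_def\<close>)

lemma int_power_series_power:
  "int_power_series f \<Longrightarrow> int_power_series (\<lambda>q. f q ^ n)"
  by (induction n) (auto intro: int_power_series_mult int_power_series_const_1)

lemma int_power_series_prod:
  fixes N :: nat
  shows "(\<And>j. int_power_series (f j)) \<Longrightarrow> int_power_series (\<lambda>q. \<Prod>j<N. f j q)"
  by (induction N) (auto intro: int_power_series_mult int_power_series_const_1)

lemma int_power_series_inverse:
  assumes f: "int_power_series f" and nz: "\<And>q. norm q < 1 \<Longrightarrow> f q \<noteq> 0" and f0: "f 0 = 1"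
  shows "int_power_series (\<lambda>q. inverse (f q))"
proof (rule int_power_seriesI)
  have F0: "fps_nth (fps_expansion f 0) 0 = 1"
    using f0 by (simp add: fps_expansion_def)
  show "(\<lambda>q. inverse (f q)) has_fps_expansion inverse (fps_expansion f 0)"
    using f F0 by (intro has_fps_expansion_inverse int_power_series_expansion) auto
  show "(\<lambda>q. inverse (f q)) holomorphic_on ball 0 1"
    using f nz by (intro holomorphic_intros) (auto simp: int_power_series_def)
  show "fps_nth (inverse (fps_expansion f 0)) n \<in> \<int>" for n
    using f F0 by (intro fps_inverse_Ints) (auto simp: int_power_series_def)
qed

lemma int_power_series_limit:
  assumes f: "\<And>N. int_power_series (f N)"
    and lim: "\<And>r. 0 < r \<Longrightarrow> r < 1 \<Longrightarrow> uniform_limit (cball 0 r) f g sequentially"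
  shows "int_power_series g"
proof -
  have hol: "f N holomorphic_on ball 0 1" for N
    using f by (simp add: int_power_series_def)
  have "g holomorphic_on ball 0 1"
  proof (rule holomorphic_uniform_sequence[OF open_ball hol])
    fix x :: complex assume x: "x \<in> ball 0 1"
    define d where "d = (1 - norm x) / 2"
    define r where "r = (1 + norm x) / 2"
    have r: "0 < r" "r < 1" "0 < d"
      using x norm_ge_zero[of x] by (auto simp: r_def d_def field_simps add_pos_nonneg)
    have sub: "cball x d \<subseteq> cball 0 r"
    proof
      fix y assume "y \<in> cball x d"
      hence "norm (y - x) \<le> d" by (simp add: dist_norm norm_minus_commute)
      moreover have "norm y \<le> norm (y - x) + norm x"
        using norm_triangle_ineq[of "y - x" x] by simp
      ultimately show "y \<in> cball 0 r" by (simp add: d_def r_def field_simps)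
    qed
    have "uniform_limit (cball x d) f g sequentially"
      using uniform_limit_on_subset[OF lim[OF r(1,2)] sub] .
    moreover have "cball x d \<subseteq> ball 0 1" using sub r by force
    ultimately show "\<exists>d>0. cball x d \<subseteq> ball 0 1 \<and> uniform_limit (cball x d) f g sequentially"
      using r by blast
  qed
  moreover have "fps_nth (fps_expansion g 0) n \<in> \<int>" for n
  proof -
    have "uniform_limit (cball 0 (1/2)) f g sequentially"
      by (rule lim) auto
    hence ul: "uniform_limit (ball 0 (1/2)) f g sequentially"
      by (rule uniform_limit_on_subset) auto
    have "(\<lambda>N. (deriv ^^ n) (f N) 0) \<longlonglongrightarrow> (deriv ^^ n) g 0"
      by (rule higher_deriv_complex_uniform_limit[OF ul])
         (auto intro!: always_eventually holomorphic_on_subset[OF hol])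
    hence "(\<lambda>N. fps_nth (fps_expansion (f N) 0) n) \<longlonglongrightarrow> fps_nth (fps_expansion g 0) n"
      unfolding fps_expansion_def by (simp add: tendsto_divide)
    moreover have "closed (\<int> :: complex set)" by (rule closed_Ints)
    moreover have "\<forall>N. fps_nth (fps_expansion (f N) 0) n \<in> \<int>"
      using f by (simp add: int_power_series_def)
    ultimately show ?thesis
      by (metis (no_types, lifting) closed_sequentially)
  qed
  ultimately show ?thesis by (simp add: int_power_series_def)
qed

context
  fixes s :: int and m :: nat
  assumes s: "\<bar>s\<bar> = 1" and m: "m > 0"
begin

lemma abs_of_int_s: "\<bar>of_int s :: real\<bar> = 1"
  using s by linarith

lemma norm_qpoch_factor_le:
  fixes q :: complex
  assumes "norm q \<le> r" "r < 1"
  shows "norm (- (of_int s * q ^ m * (q ^ m) ^ j)) \<le> r * r ^ j"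
proof -
  have r0: "0 \<le> r" using assms norm_ge_zero[of q] by linarith
  have "norm (q ^ m) \<le> r ^ m" using assms by (simp add: norm_power power_mono)
  also have "r ^ m \<le> r ^ 1"
    using r0 assms m by (intro power_decreasing) auto
  finally have qm: "norm (q ^ m) \<le> r" by simp
  hence "norm ((q ^ m) ^ j) \<le> r ^ j"
    by (metis norm_ge_zero norm_power power_mono)
  with qm r0 have "norm (q ^ m) * norm ((q ^ m) ^ j) \<le> r * r ^ j"
    by (intro mult_mono) auto
  thus ?thesis by (simp add: norm_mult abs_of_int_s)
qed

lemma qpoch_inf_nonzero:
  assumes "norm q < 1"
  shows "qpoch_inf (of_int s * q ^ m) (q ^ m) \<noteq> 0"
    and "convergent_prod (\<lambda>j. 1 - of_int s * q ^ m * (q ^ m) ^ j)"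
proof -
  have "summable (\<lambda>j. norm q * norm q ^ j)"
    using assms by (intro summable_mult summable_geometric) auto
  hence "summable (\<lambda>j. norm (- (of_int s * q ^ m * (q ^ m) ^ j)))"
    by (rule summable_comparison_test') (use norm_qpoch_factor_le[OF order_refl assms] in auto)
  hence "abs_convergent_prod (\<lambda>j. 1 + - (of_int s * q ^ m * (q ^ m) ^ j))"
    by (intro summable_imp_abs_convergent_prod) simp
  thus *: "convergent_prod (\<lambda>j. 1 - of_int s * q ^ m * (q ^ m) ^ j)"
    by (simp add: abs_convergent_prod_imp_convergent_prod)
  have "1 - of_int s * q ^ m * (q ^ m) ^ j \<noteq> 0" for j
  proof
    assume "1 - of_int s * q ^ m * (q ^ m) ^ j = 0"
    hence "norm (of_int s * q ^ m * (q ^ m) ^ j) = 1" by simp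
    hence "norm q ^ (m * Suc j) = 1"
      by (simp add: norm_mult abs_of_int_s norm_power power_mult power_add)
    moreover have "norm q ^ (m * Suc j) < 1"
      using assms m by (intro power_less_one_iff[THEN iffD2]) auto
    ultimately show False by simp
  qed
  thus "qpoch_inf (of_int s * q ^ m) (q ^ m) \<noteq> 0"
    unfolding qpoch_inf_def using prodinf_nonzero[OF *] by blast
qed

lemma int_power_series_qpoch_inf:
  "int_power_series (\<lambda>q. qpoch_inf (of_int s * q ^ m) (q ^ m))"
proof (rule int_power_series_limit)
  fix N
  show "int_power_series (\<lambda>q. \<Prod>j<N. 1 - of_int s * q ^ m * (q ^ m) ^ j)"
  proof (rule int_power_series_prod)
    fix j
    show "int_power_series (\<lambda>q. 1 - of_int s * q ^ m * (q ^ m) ^ j)"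
    proof (rule int_power_seriesI)
      show "(\<lambda>q::complex. 1 - of_int s * q ^ m * (q ^ m) ^ j) has_fps_expansion
              1 - fps_const (of_int s) * fps_X ^ m * (fps_X ^ m) ^ j"
        by (intro fps_expansion_intros)
      have pow: "fps_X ^ m * (fps_X ^ m) ^ j = (fps_X ^ (m + m * j) :: complex fps)"
        by (simp only: power_add power_mult)
      have eq: "1 - fps_const (of_int s) * fps_X ^ m * (fps_X ^ m) ^ j =
            1 - fps_const (of_int s :: complex) * fps_X ^ (m + m * j)"
        by (simp only: mult.assoc pow)
      show "fps_nth (1 - fps_const (of_int s :: complex) * fps_X ^ m * (fps_X ^ m) ^ j) n \<in> \<int>" for n
        by (subst eq) (rule fps_one_minus_monom_Ints)
    qed (auto intro!: holomorphic_intros)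
  qed
next
  fix r :: real assume r: "0 < r" "r < 1"
  define f where "f = (\<lambda>j q. 1 + - (of_int s * q ^ m * (q ^ m) ^ j) :: complex)"
  have "uniformly_convergent_on (cball 0 r) (\<lambda>N q. \<Prod>j<N. f j q)"
    unfolding f_def
  proof (rule uniformly_convergent_on_prod)
    show "uniformly_convergent_on (cball 0 r)
            (\<lambda>N q::complex. \<Sum>n<N. norm (- (of_int s * q ^ m * (q ^ m) ^ n)))"
    proof (rule Weierstrass_m_test')
      show "summable (\<lambda>j. r * r ^ j)"
        using r by (intro summable_mult summable_geometric) auto
    qed (use norm_qpoch_factor_le r in auto)
  qed (auto intro!: continuous_intros)
  then obtain g where g: "uniform_limit (cball 0 r) (\<lambda>N q. \<Prod>j<N. f j q) g sequentially"
    by (auto simp: uniformly_convergent_on_def)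
  have geq: "g q = qpoch_inf (of_int s * q ^ m) (q ^ m)" if q: "q \<in> cball 0 r" for q
  proof -
    have "norm q < 1" using q r by simp
    hence "(\<lambda>N. \<Prod>j\<le>N. f j q) \<longlonglongrightarrow> qpoch_inf (of_int s * q ^ m) (q ^ m)"
      unfolding qpoch_inf_def f_def
      using convergent_prod_LIMSEQ[OF qpoch_inf_nonzero(2)] by simp
    hence "(\<lambda>N. \<Prod>j<N. f j q) \<longlonglongrightarrow> qpoch_inf (of_int s * q ^ m) (q ^ m)"
      by (simp add: LIMSEQ_lessThan_iff_atMost)
    thus ?thesis
      using tendsto_uniform_limitI[OF g q] LIMSEQ_unique by blast
  qed
  have "uniform_limit (cball 0 r) (\<lambda>N q. \<Prod>j<N. f j q)
      (\<lambda>q. qpoch_inf (of_int s * q ^ m) (q ^ m)) sequentially"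
    by (rule uniform_limit_cong[THEN iffD1, OF _ _ g]) (use geq in auto)
  thus "uniform_limit (cball 0 r) (\<lambda>N q. \<Prod>j<N. 1 - of_int s * q ^ m * (q ^ m) ^ j)
      (\<lambda>q. qpoch_inf (of_int s * q ^ m) (q ^ m)) sequentially"
    unfolding f_def by simp
qed

end

lemma qpoch_inf_0_left: "qpoch_inf 0 q = 1"
  by (simp add: qpoch_inf_def)

theorem dots_bracelet_unique_sequence:
  assumes k: "k \<ge> 3"
  shows "\<exists>!B :: nat \<Rightarrow> int. \<forall>q. norm q < 1 \<longrightarrow>
           (\<lambda>n. of_int (B n) * q ^ n) sums dots_bracelet_gf k q"
proof (rule ex_ex1I)
  have A: "int_power_series (\<lambda>q. qpoch_inf (- q) q)"
    using int_power_series_qpoch_inf[of "-1" 1] by simp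
  have D: "int_power_series (\<lambda>q. qpoch_inf q q ^ (k - 1) * qpoch_inf (- (q ^ k)) (q ^ k))"
    using int_power_series_qpoch_inf[of 1 1] int_power_series_qpoch_inf[of "-1" k] k
    by (intro int_power_series_mult int_power_series_power) simp_all
  have "int_power_series (\<lambda>q. qpoch_inf (- q) q *
          inverse (qpoch_inf q q ^ (k - 1) * qpoch_inf (- (q ^ k)) (q ^ k)))"
  proof (intro int_power_series_mult[OF A] int_power_series_inverse[OF D])
    fix q :: complex assume q: "norm q < 1"
    show "qpoch_inf q q ^ (k - 1) * qpoch_inf (- (q ^ k)) (q ^ k) \<noteq> 0"
      using qpoch_inf_nonzero(1)[of 1 1 q] qpoch_inf_nonzero(1)[of "-1" k q] k q by simp
  qed (use k in \<open>simp_all add: qpoch_inf_0_left power_0_left\<close>)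
  hence gf: "int_power_series (dots_bracelet_gf k)"
    by (simp add: dots_bracelet_gf_def[abs_def] divide_inverse)
  define B where "B = (\<lambda>n. \<lfloor>Re (fps_nth (fps_expansion (dots_bracelet_gf k) 0) n)\<rfloor>)"
  have B: "of_int (B n) = fps_nth (fps_expansion (dots_bracelet_gf k) 0) n" for n
  proof -
    have "fps_nth (fps_expansion (dots_bracelet_gf k) 0) n \<in> \<int>"
      using gf by (simp add: int_power_series_def)
    then obtain z where z: "fps_nth (fps_expansion (dots_bracelet_gf k) 0) n = of_int z"
      by (elim Ints_cases)
    show ?thesis
      unfolding B_def z by simp
  qed
  have "(\<lambda>n. of_int (B n) * q ^ n) sums dots_bracelet_gf k q" if "norm q < 1" for q
    using holomorphic_power_series[of "dots_bracelet_gf k" 0 1 q] gf that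
    by (simp add: B fps_expansion_def int_power_series_def)
  thus "\<exists>B :: nat \<Rightarrow> int. \<forall>q. norm q < 1 \<longrightarrow>
           (\<lambda>n. of_int (B n) * q ^ n) sums dots_bracelet_gf k q"
    by blast
next
  fix B C :: "nat \<Rightarrow> int"
  assume BC: "\<forall>q. norm q < 1 \<longrightarrow> (\<lambda>n. of_int (B n) * q ^ n) sums dots_bracelet_gf k q"
             "\<forall>q. norm q < 1 \<longrightarrow> (\<lambda>n. of_int (C n) * q ^ n) sums dots_bracelet_gf k q"
  have expan: "dots_bracelet_gf k has_fps_expansion Abs_fps (\<lambda>n. of_int (X n))"
    if "\<forall>q. norm q < 1 \<longrightarrow> (\<lambda>n. of_int (X n) * q ^ n) sums dots_bracelet_gf k q" for X :: "nat \<Rightarrow> int"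
  proof (rule has_fps_expansionI)
    have "eventually (\<lambda>q::complex. q \<in> ball 0 1) (nhds 0)"
      by (intro eventually_nhds_in_open) auto
    thus "\<forall>\<^sub>F q in nhds 0. (\<lambda>n. fps_nth (Abs_fps (\<lambda>n. of_int (X n))) n * q ^ n)
            sums dots_bracelet_gf k q"
      by eventually_elim (use that in auto)
  qed
  have "Abs_fps (\<lambda>n. of_int (B n) :: complex) = Abs_fps (\<lambda>n. of_int (C n))"
    using expan[OF BC(1)] expan[OF BC(2)] by (metis has_fps_expansion_imp_fps_expansion_eq)
  thus "B = C"
    by (auto simp: fps_eq_iff)
qed

lemma dots_bracelet_sums:
  assumes "k \<ge> 3" "norm q < 1"
  shows "(\<lambda>n. of_int (dots_bracelet k n) * q ^ n) sums dots_bracelet_gf k q"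
proof -
  have "\<forall>q. norm q < 1 \<longrightarrow> (\<lambda>n. of_int (dots_bracelet k n) * q ^ n) sums dots_bracelet_gf k q"
    unfolding dots_bracelet_def by (rule theI'[OF dots_bracelet_unique_sequence[OF assms(1)]])
  thus ?thesis using assms(2) by simp
qed

end

theory Submission
  imports Defs "HOL-Library.Z2"
begin

text \<open>
  Write \<open>f\<^sub>c\<close> for the Euler product \<open>\<Prod>j\<ge>1. 1 - q\<^bsup>cj\<^esup>\<close>. Since \<open>(-q;q)\<close> is \<open>f\<^sub>2 / f\<^sub>1\<close> and
  \<open>f\<^sub>2 = f\<^sub>1\<^sup>2\<close> over the field with two elements, the generating function for \<open>k = 5\<close> reduces to
  \<open>1 / (f\<^sub>1\<^sup>3 f\<^sub>5)\<close> modulo 2 (\<open>dots_bracelet_bit_fps\<close>). The whole proof lives in the power series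
  ring over that field, where a square has only even exponents, so that writing a series as
  \<open>Y\<^sup>2 + q Z\<^sup>2\<close> separates its coefficients of even and of odd index.

  The one identity that produces such decompositions is \<open>f\<^sub>1 f\<^sub>5 = f\<^sub>1\<^sup>6 + q f\<^sub>5\<^sup>6\<close>. Dividing it by
  suitable squares three times in a row shows that the coefficient of \<open>q\<^bsup>8m+4\<^esup>\<close> in
  \<open>1 / (f\<^sub>1\<^sup>3 f\<^sub>5)\<close> is that of \<open>q\<^bsup>m\<^esup>\<close> in \<open>f\<^sub>1 f\<^sub>5\<^sup>2 = f\<^sub>1 f\<^sub>1\<^sub>0\<close> (\<open>bracelet_series_coeff\<close>). By the
  pentagonal number theorem the latter counts, modulo 2, solutions of \<open>x\<^sup>2 + 10 y\<^sup>2 = 24 m + 11\<close> in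
  integers congruent to 1 modulo 6. In the four progressions of the theorem, \<open>24 m + 11\<close> is
  a power of 25 times a number \<open>M\<close>, where \<open>M\<close> is either congruent to 2 or 3 modulo 5, or 5
  times a number congruent to 1 or 4 modulo 5. The prime 5 is ramified in the form
  \<open>x\<^sup>2 + 10 y\<^sup>2\<close>, so the power of 25 can be removed, and such an \<open>M\<close> is excluded by quadratic
  residues (\<open>form_1_10_not_rep\<close>). There are no solutions and the coefficient is even.

  Two classical ingredients are proved on the way. The pentagonal number theorem follows
  from Shanks' finite version of it. The identity for \<open>f\<^sub>1 f\<^sub>5\<close>, and likewise
  \<open>f\<^sub>1 f\<^sub>2 = \<Sum>q\<^bsup>n(n+1)/2\<^esup>\<close>, which is needed to recognise \<open>f\<^sub>1\<^sup>3\<close>, are statements about the parity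
  of the number of solutions of \<open>x\<^sup>2 + D y\<^sup>2 = (D + 1) N\<close> for \<open>D = 5\<close> and \<open>D = 2\<close>. Dividing by
  \<open>1 + \<surd>-D\<close> turns them into statements about \<open>u\<^sup>2 + D v\<^sup>2 = N\<close>, and \<open>odd_card_reps\<close> settles both
  at once, by involutions and a descent at the prime 3, which splits for both \<open>D\<close>.
\<close>

section \<open>Parity of representation numbers of u^2 + 2 v^2 and u^2 + 5 v^2\<close>

text \<open>
  By default the simplifier rewrites addition and multiplication of bits to bitwise
  operations, out of reach of the ring lemmas used below.
\<close>
declare add_bit_eq_xor [simp del] mult_bit_eq_and [simp del]

lemma even_card_iff_even_card_fixpoints:
  assumes fin: "finite S"
    and h: "\<And>x. x \<in> S \<Longrightarrow> h x \<in> S" "\<And>x. x \<in> S \<Longrightarrow> h (h x) = x"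
  shows "even (card S) \<longleftrightarrow> even (card {x \<in> S. h x = x})"
proof -
  let ?F = "{x \<in> S. h x = x}"
  have "(\<Sum>x\<in>S - ?F. 1 :: bit) = 0"
    by (rule sum_involution_eq_0[where h = h]) (use h in auto)
  hence "(of_nat (card (S - ?F)) :: bit) = 0"
    by simp
  hence "even (of_nat (card (S - ?F)) :: bit)"
    by (simp only: dvd_0_right)
  hence "even (card (S - ?F))"
    by (simp only: even_of_nat_iff)
  moreover have "card S = card ?F + card (S - ?F)"
    using fin by (subst card_Un_disjoint [symmetric]) (auto intro: arg_cong[where f = card])
  ultimately show ?thesis by simp
qed

text \<open>
  The condition modulo 3 selects one solution from each pair \<open>\<plusminus>(u, v)\<close> with \<open>u + v\<close> not divisible
  by 3. For \<open>c = 1\<close> and \<open>d = D\<close> congruent to 2 modulo 3, in the ring of \<open>\<surd>-D\<close>, divisibility of \<open>u + v\<close> by 3 means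
  divisibility of \<open>u + v\<surd>-D\<close> by one of the two primes above 3.
\<close>
definition reps :: "int \<Rightarrow> int \<Rightarrow> int \<Rightarrow> (int \<times> int) set" where
  "reps c d N = {(u, v). c * u ^ 2 + d * v ^ 2 = N \<and> (u + v) mod 3 = 1}"

lemma abs_le_power2: "\<bar>x\<bar> \<le> x ^ 2" for x :: int
proof (cases "x = 0")
  case False
  hence "\<bar>x\<bar> ^ 1 \<le> \<bar>x\<bar> ^ 2" by (intro power_increasing) auto
  thus ?thesis by simp
qed simp

lemma finite_int_bounded: "finite {(x :: int, y :: int). \<bar>x\<bar> \<le> N \<and> \<bar>y\<bar> \<le> N}"
proof (rule finite_subset)
  show "{(x :: int, y :: int). \<bar>x\<bar> \<le> N \<and> \<bar>y\<bar> \<le> N} \<subseteq> {-N..N} \<times> {-N..N}"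
    by auto
qed simp

lemma finite_form_solutions:
  assumes "c > 0" "d > (0 :: int)"
  shows "finite {(x, y). c * x ^ 2 + d * y ^ 2 = N}"
proof (rule finite_subset[OF _ finite_int_bounded[of N]], clarify)
  fix x y assume "N = c * x ^ 2 + d * y ^ 2"
  moreover have "1 * x ^ 2 \<le> c * x ^ 2" "1 * y ^ 2 \<le> d * y ^ 2"
    using assms by (intro mult_right_mono; simp)+
  moreover have "0 \<le> x ^ 2" "0 \<le> y ^ 2" by auto
  ultimately show "\<bar>x\<bar> \<le> c * x ^ 2 + d * y ^ 2 \<and> \<bar>y\<bar> \<le> c * x ^ 2 + d * y ^ 2"
    using abs_le_power2[of x] abs_le_power2[of y] by linarith
qed

lemma finite_reps: "c > 0 \<Longrightarrow> d > 0 \<Longrightarrow> finite (reps c d N)"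
  by (rule finite_subset[OF _ finite_form_solutions[of c d N]]) (auto simp: reps_def)

lemma square_mod_3: "(x ^ 2) mod 3 = (if 3 dvd x then 0 else 1)" for x :: int
proof -
  have "x mod 3 = 0 \<or> x mod 3 = 1 \<or> x mod 3 = 2" by presburger
  hence "(x mod 3) ^ 2 mod 3 = (if x mod 3 = 0 then 0 else 1)" by auto
  thus ?thesis by (simp add: power_mod dvd_eq_mod_eq_0)
qed

lemma square_mod_4: "(x ^ 2) mod 4 = (if even x then 0 else 1)" for x :: int
proof -
  have "x mod 4 = 0 \<or> x mod 4 = 1 \<or> x mod 4 = 2 \<or> x mod 4 = 3" by presburger
  hence "(x mod 4) ^ 2 mod 4 = (if even (x mod 4) then 0 else 1)" by auto
  moreover have "even (x mod 4) \<longleftrightarrow> even x" by presburger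
  ultimately show ?thesis by (simp add: power_mod)
qed

lemma form_mod_3:
  fixes c d u v :: int
  assumes "(c + d) mod 3 = 0" "(u + v) mod 3 = 1"
  shows "(u mod 3 = 1 \<and> v mod 3 = 0 \<and> (c * u ^ 2 + d * v ^ 2) mod 3 = c mod 3) \<or>
         (u mod 3 = 0 \<and> v mod 3 = 1 \<and> (c * u ^ 2 + d * v ^ 2) mod 3 = d mod 3) \<or>
         (u mod 3 = 2 \<and> v mod 3 = 2 \<and> (c * u ^ 2 + d * v ^ 2) mod 3 = 0)"
proof -
  have "(c * u ^ 2 + d * v ^ 2) mod 3 = (c * (u ^ 2 mod 3) + d * (v ^ 2 mod 3)) mod 3"
    by (rule mod_add_cong) (simp_all add: mod_mult_right_eq)
  hence eq: "(c * u ^ 2 + d * v ^ 2) mod 3 =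
      (c * (if u mod 3 = 0 then 0 else 1) + d * (if v mod 3 = 0 then 0 else 1)) mod 3"
    by (simp only: square_mod_3 dvd_eq_mod_eq_0)
  have "(u mod 3 = 1 \<and> v mod 3 = 0) \<or> (u mod 3 = 0 \<and> v mod 3 = 1) \<or> (u mod 3 = 2 \<and> v mod 3 = 2)"
    using assms(2) by presburger
  thus ?thesis
    unfolding eq using assms(1) by (elim disjE conjE) simp_all
qed

text \<open>
  Here every solution has \<open>v\<close> divisible by 3, so \<open>v \<mapsto> -v\<close> preserves the normalisation modulo 3
  and leaves fixed only a solution with \<open>v = 0\<close>.
\<close>
lemma odd_card_reps_coprime_3:
  assumes cd: "c > 0" "d > 0" "(c + d) mod 3 = 0" and N: "N mod 3 = c mod 3" "N mod 3 \<noteq> 0"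
  shows "odd (card (reps c d N)) \<longleftrightarrow> (\<exists>w. c * w ^ 2 = N)"
proof -
  let ?h = "\<lambda>(u, v). (u, - v) :: int \<times> int"
  have "c mod 3 \<noteq> d mod 3" using cd N by presburger
  have "even (card (reps c d N)) \<longleftrightarrow> even (card {p \<in> reps c d N. ?h p = p})"
  proof (rule even_card_iff_even_card_fixpoints[OF finite_reps[OF cd(1,2)]])
    fix p assume p: "p \<in> reps c d N"
    then obtain u v where [simp]: "p = (u, v)" by (cases p)
    have uv: "c * u ^ 2 + d * v ^ 2 = N" "(u + v) mod 3 = 1"
      using p by (auto simp: reps_def)
    have "v mod 3 = 0"
      using form_mod_3[OF cd(3) uv(2)] N \<open>c mod 3 \<noteq> d mod 3\<close> unfolding uv(1) by auto
    hence "(u - v) mod 3 = 1" using uv(2) by presburger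
    thus "?h p \<in> reps c d N" using uv by (auto simp: reps_def)
    show "?h (?h p) = p" by simp
  qed
  also have "{p \<in> reps c d N. ?h p = p} = (\<lambda>u. (u, 0)) ` {u. c * u ^ 2 = N \<and> u mod 3 = 1}"
    by (auto simp: reps_def)
  also have "card \<dots> = card {u. c * u ^ 2 = N \<and> u mod 3 = 1}"
    by (rule card_image) (auto simp: inj_on_def)
  also have "\<dots> = of_bool (\<exists>w. c * w ^ 2 = N)"
  proof (cases "\<exists>w. c * w ^ 2 = N")
    case True
    then obtain w where w: "c * w ^ 2 = N" by blast
    have "w mod 3 \<noteq> 0"
    proof
      assume "w mod 3 = 0"
      hence "3 dvd c * w ^ 2" by (auto simp: power2_eq_square)
      thus False using w N by auto
    qed
    define x where "x = (if w mod 3 = 1 then w else - w)"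
    have x2: "c * x ^ 2 = N" using w by (simp add: x_def)
    have x3: "x mod 3 = 1"
      using \<open>w mod 3 \<noteq> 0\<close> unfolding x_def by presburger
    have "u = x" if "c * u ^ 2 = N" "u mod 3 = 1" for u
    proof -
      have "u ^ 2 = x ^ 2" using that x2 cd by auto
      hence "u = x \<or> u = - x" by (simp add: power2_eq_iff)
      thus ?thesis using that x3 by presburger
    qed
    hence "{u. c * u ^ 2 = N \<and> u mod 3 = 1} = {x}" using x2 x3 by blast
    thus ?thesis using True by simp
  qed auto
  finally show ?thesis by simp
qed

lemma card_reps_swap: "card (reps c d N) = card (reps d c N)"
  by (rule bij_betw_same_card[of prod.swap], rule bij_betw_byWitness[of _ prod.swap])
     (auto simp: reps_def add.commute)

text \<open>
  Since \<open>a\<^sup>2 + D b\<^sup>2 = 9\<close>, multiplication by \<open>(a + b\<surd>-D) / 3\<close> followed by conjugation is a reflection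
  that preserves the form. It maps integral solutions to integral ones because \<open>3\<close> divides \<open>N\<close>
  and hence \<open>u\<close> and \<open>v\<close> are both congruent to 2 modulo 3. A solution fixed up to sign lies on one
  of its two axes, which forces \<open>N\<close> to be 3, 6 or 30 times a square, against \<open>N mod 4 = 1\<close>.
\<close>
lemma even_card_reps_exactly_3:
  fixes D a b N :: int
  assumes D: "(D, a, b) \<in> {(2, -1, -2), (5, 2, 1)}"
    and N: "3 dvd N" "\<not> 9 dvd N" "N mod 4 = 1"
  shows "even (card (reps 1 D N))"
proof -
  \<comment> \<open>The sign that brings the reflected solution back to coordinate sum 1 modulo 3.\<close>
  define e :: int where "e = (if N mod 9 = 3 then 1 else -1)"
  define h where "h = (\<lambda>(u, v). (e * ((a * u - D * b * v) div 3), - e * ((b * u + a * v) div 3)))"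
  have "D > 0" using D by auto
  have e: "e = 1 \<and> N mod 9 = 3 \<or> e = -1 \<and> N mod 9 = 6"
    using N(1,2) unfolding e_def by presburger
  have not3: "N \<noteq> 3 * w ^ 2" for w
    using N(3) mod_mult_right_eq[of 3 "w ^ 2" 4] by (auto simp: square_mod_4 split: if_splits)
  have not6: "N \<noteq> 6 * w ^ 2" "N \<noteq> 30 * w ^ 2" for w
    using N(3) by presburger+
  have key: "h p \<in> reps 1 D N" "h (h p) = p" "h p \<noteq> p" if p: "p \<in> reps 1 D N" for p
  proof -
    obtain u v where [simp]: "p = (u, v)" by (cases p)
    have uv: "u ^ 2 + D * v ^ 2 = N" "(u + v) mod 3 = 1"
      using p by (auto simp: reps_def)
    have "(1 + D) mod 3 = 0" using D by auto
    from form_mod_3[OF this uv(2)] have "u mod 3 = 2" "v mod 3 = 2"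
      using uv(1) N(1) D by auto
    then obtain s t where st: "u = 3 * s + 2" "v = 3 * t + 2"
      by (metis mult_div_mod_eq)
    have "h p \<in> reps 1 D N \<and> h (h p) = p \<and> h p \<noteq> p"
      using D
    proof (elim insertE emptyE)
      assume "(D, a, b) = (2, -1, -2)"
      hence [simp]: "D = 2" "a = -1" "b = -2" by simp_all
      define w where "w = s + 2 * t + 1"
      have N9: "N = 9 * (s^2 + 2 * t^2) + 12 * w"
        unfolding uv(1)[symmetric] by (simp add: st w_def power2_eq_square algebra_simps)
      have "N mod 9 = 12 * w mod 9"
        unfolding N9 by (rule mod_mult_self4)
      have "w mod 3 = 1" if "12 * w mod 9 = 3" using that by presburger
      moreover have "- w mod 3 = 1" if "12 * w mod 9 = 6" using that by presburger
      ultimately have "e * w mod 3 = 1"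
        using e \<open>N mod 9 = 12 * w mod 9\<close> by auto
      moreover have "e * (4 * t - s + 2) + e * (2 * s + t + 2) = e * w + 3 * (e * (t + 1))"
        by (simp add: w_def algebra_simps)
      ultimately have "(e * (4 * t - s + 2) + e * (2 * s + t + 2)) mod 3 = 1"
        by (simp only: mod_mult_self2)
      moreover have q: "a * u - D * b * v = 3 * (4 * t - s + 2)"
                       "b * u + a * v = 3 * - (2 * s + t + 2)"
        by (simp_all add: st)
      have hp: "h p = (e * (4 * t - s + 2), e * (2 * s + t + 2))"
        by (simp only: h_def \<open>p = (u, v)\<close> prod.case q nonzero_mult_div_cancel_left) (simp add: algebra_simps)
      moreover have "(e * (4 * t - s + 2)) ^ 2 + 2 * (e * (2 * s + t + 2)) ^ 2 = N"
        using e uv(1)[symmetric] by (auto simp: st power2_eq_square algebra_simps)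
      moreover have "h (h p) = p"
        unfolding hp using e by (auto simp: h_def st)
      moreover have "h p \<noteq> p"
      proof
        assume "h p = p"
        hence "(u, v) = (e * (4 * t - s + 2), e * (2 * s + t + 2))"
          using hp \<open>p = (u, v)\<close> by metis
        hence "u = v \<or> u = - 2 * v" using e by (auto simp: st)
        thus False using uv(1) not3[of v] not6[of v] by auto
      qed
      ultimately show ?thesis by (simp add: reps_def)
    next
      assume "(D, a, b) = (5, 2, 1)"
      hence [simp]: "D = 5" "a = 2" "b = 1" by simp_all
      define w where "w = s + 2 * t + 2"
      have N9: "N = 9 * (s^2 + 5 * t^2 + 4 * t) + 12 * w"
        unfolding uv(1)[symmetric] by (simp add: st w_def power2_eq_square algebra_simps)
      have "N mod 9 = 12 * w mod 9"
        unfolding N9 by (rule mod_mult_self4)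
      have "w mod 3 = 1" if "12 * w mod 9 = 3" using that by presburger
      moreover have "- w mod 3 = 1" if "12 * w mod 9 = 6" using that by presburger
      ultimately have "e * w mod 3 = 1"
        using e \<open>N mod 9 = 12 * w mod 9\<close> by auto
      moreover have "e * (2 * s - 5 * t - 2) + - e * (s + 2 * t + 2) = e * w + 3 * (e * (- 3 * t - 2))"
        by (simp add: w_def algebra_simps)
      ultimately have "(e * (2 * s - 5 * t - 2) + - e * (s + 2 * t + 2)) mod 3 = 1"
        by (simp only: mod_mult_self2)
      moreover have q: "a * u - D * b * v = 3 * (2 * s - 5 * t - 2)"
                       "b * u + a * v = 3 * (s + 2 * t + 2)"
        by (simp_all add: st)
      have hp: "h p = (e * (2 * s - 5 * t - 2), - e * (s + 2 * t + 2))"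
        by (simp only: h_def \<open>p = (u, v)\<close> prod.case q nonzero_mult_div_cancel_left)
      moreover have "(e * (2 * s - 5 * t - 2)) ^ 2 + 5 * (- e * (s + 2 * t + 2)) ^ 2 = N"
        using e uv(1)[symmetric] by (auto simp: st power2_eq_square algebra_simps)
      moreover have "h (h p) = p"
        unfolding hp using e by (auto simp: h_def st)
      moreover have "h p \<noteq> p"
      proof
        assume "h p = p"
        hence "(u, v) = (e * (2 * s - 5 * t - 2), - e * (s + 2 * t + 2))"
          using hp \<open>p = (u, v)\<close> by metis
        hence "u = v \<or> u = - 5 * v" using e by (auto simp: st)
        thus False using uv(1) not6[of v] by auto
      qed
      ultimately show ?thesis by (simp add: reps_def)
    qed
    thus "h p \<in> reps 1 D N" "h (h p) = p" "h p \<noteq> p" by blast+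
  qed
  have "even (card (reps 1 D N)) \<longleftrightarrow> even (card {p \<in> reps 1 D N. h p = p})"
    by (rule even_card_iff_even_card_fixpoints) (use key \<open>D > 0\<close> in \<open>auto intro: finite_reps\<close>)
  also have "{p \<in> reps 1 D N. h p = p} = {}" using key by blast
  finally show ?thesis by simp
qed

text \<open>
  Multiplication by \<open>a - b\<surd>-D\<close>, of norm 9, generator of the square of one prime above 3. A solution
  for \<open>9 N\<close> that avoids the other prime must contain this square, so the map is onto; the signs of
  \<open>a\<close> and \<open>b\<close> are chosen to keep \<open>u + v\<close> unchanged modulo 3.
\<close>
lemma card_reps_9:
  fixes D a b N :: int
  assumes D: "(D, a, b) \<in> {(2, -1, -2), (5, 2, 1)}"
  shows "card (reps 1 D (9 * N)) = card (reps 1 D N)"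
proof (rule bij_betw_same_card[symmetric])
  define g where "g = (\<lambda>(u, v). (a * u + D * b * v, a * v - b * u))"
  define g' where "g' = (\<lambda>(u, v). ((a * u - D * b * v) div 9, (a * v + b * u) div 9))"
  show "bij_betw g (reps 1 D N) (reps 1 D (9 * N))"
  proof (rule bij_betw_byWitness[of _ g'])
    show "\<forall>p\<in>reps 1 D N. g' (g p) = p"
      using D by (auto simp: g_def g'_def algebra_simps)
    show "g ` reps 1 D N \<subseteq> reps 1 D (9 * N)"
    proof (rule image_subsetI)
      fix p assume "p \<in> reps 1 D N"
      moreover obtain u v where [simp]: "p = (u, v)" by (cases p)
      ultimately have uv: "u ^ 2 + D * v ^ 2 = N" "(u + v) mod 3 = 1" by (auto simp: reps_def)
      show "g p \<in> reps 1 D (9 * N)"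
        using D
      proof (elim insertE emptyE)
        assume "(D, a, b) = (2, -1, -2)"
        hence [simp]: "D = 2" "a = -1" "b = -2" by simp_all
        have "(- u - 4 * v + (2 * u - v)) mod 3 = 1" using uv(2) by presburger
        thus ?thesis using uv(1)[symmetric]
          by (auto simp: g_def reps_def power2_eq_square algebra_simps)
      next
        assume "(D, a, b) = (5, 2, 1)"
        hence [simp]: "D = 5" "a = 2" "b = 1" by simp_all
        have "(2 * u + 5 * v + (2 * v - u)) mod 3 = 1" using uv(2) by presburger
        thus ?thesis using uv(1)[symmetric]
          by (auto simp: g_def reps_def power2_eq_square algebra_simps)
      qed
    qed
    have *: "g (g' (u, v)) = (u, v) \<and> g' (u, v) \<in> reps 1 D N" if "(u, v) \<in> reps 1 D (9 * N)" for u v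
    proof -
      have uv: "u ^ 2 + D * v ^ 2 = 9 * N" "(u + v) mod 3 = 1" using that by (auto simp: reps_def)
      have "(1 + D) mod 3 = 0" using D by auto
      from form_mod_3[OF this uv(2)] have "u mod 3 = 2" "v mod 3 = 2"
        using uv(1) D by auto
      then obtain s t where st: "u = 3 * s + 2" "v = 3 * t + 2"
        by (metis mult_div_mod_eq)
      show ?thesis
        using D
      proof (elim insertE emptyE)
        assume "(D, a, b) = (2, -1, -2)"
        hence [simp]: "D = 2" "a = -1" "b = -2" by simp_all
        define w where "w = s + 2 * t + 1"
        have "9 * (N - s^2 - 2 * t^2) = 12 * w"
          using uv(1) by (simp add: st w_def power2_eq_square algebra_simps)
        hence "9 dvd 12 * w" by (metis dvd_triv_left)
        hence "3 dvd w" by presburger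
        then obtain r where "w = 3 * r" by blast
        hence "s = t + 2 + 3 * (r - t - 1)" by (simp add: w_def)
        then obtain k where k: "s = t + 2 + 3 * k" by blast
        have "a * u - D * b * v = 9 * (t - k)" "a * v + b * u = 9 * (- t - 2 - 2 * k)"
          by (simp_all add: st k)
        hence g': "g' (u, v) = (t - k, - t - 2 - 2 * k)"
          by (simp only: g'_def prod.case nonzero_mult_div_cancel_left)
        have "(t - k + (- t - 2 - 2 * k)) mod 3 = 1" by presburger
        moreover have "(t - k) ^ 2 + 2 * (- t - 2 - 2 * k) ^ 2 = N"
          using uv(1) by (simp add: st k power2_eq_square algebra_simps)
        ultimately show ?thesis unfolding g' by (simp add: g_def reps_def st k)
      next
        assume "(D, a, b) = (5, 2, 1)"
        hence [simp]: "D = 5" "a = 2" "b = 1" by simp_all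
        define w where "w = s + 2 * t + 2"
        have "9 * (N - s^2 - 5 * t^2 - 4 * t) = 12 * w"
          using uv(1) by (simp add: st w_def power2_eq_square algebra_simps)
        hence "9 dvd 12 * w" by (metis dvd_triv_left)
        hence "3 dvd w" by presburger
        then obtain r where "w = 3 * r" by blast
        hence "s = t + 1 + 3 * (r - t - 1)" by (simp add: w_def)
        then obtain k where k: "s = t + 1 + 3 * k" by blast
        have "a * u - D * b * v = 9 * (2 * k - t)" "a * v + b * u = 9 * (t + 1 + k)"
          by (simp_all add: st k)
        hence g': "g' (u, v) = (2 * k - t, t + 1 + k)"
          by (simp only: g'_def prod.case nonzero_mult_div_cancel_left)
        have "(2 * k - t + (t + 1 + k)) mod 3 = 1" by presburger
        moreover have "(2 * k - t) ^ 2 + 5 * (t + 1 + k) ^ 2 = N"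
          using uv(1) by (simp add: st k power2_eq_square algebra_simps)
        ultimately show ?thesis unfolding g' by (simp add: g_def reps_def st k)
      qed
    qed
    show "\<forall>p\<in>reps 1 D (9 * N). g (g' p) = p" "g' ` reps 1 D (9 * N) \<subseteq> reps 1 D N"
      using * by auto
  qed
qed

text \<open>
  The part of \<open>N\<close> prime to 3 decides: factors 9 are removed by \<open>card_reps_9\<close>, a single factor 3
  leaves an even number of solutions (and rules out squares), and for \<open>N\<close> prime to 3 its residue
  modulo 3 determines which of the two coordinates can vanish.
\<close>
lemma odd_card_reps:
  assumes D: "D \<in> {2, 5}" and N: "N > 0" "N mod 4 = 1"
  shows "odd (card (reps 1 D N)) \<longleftrightarrow> (\<exists>w. w ^ 2 = N) \<or> (\<exists>w. D * w ^ 2 = N)"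
  using N
proof (induction "nat N" arbitrary: N rule: less_induct)
  case less
  obtain a b :: int where ab: "(D, a, b) \<in> {(2, -1, -2), (5, 2, 1)}" using D by blast
  have D': "D > 0" "(1 + D) mod 3 = 0" "(D + 1) mod 3 = 0" "D mod 3 = 2" using D by auto
  have dvd: "3 dvd w" if "c * w ^ 2 = N" "3 dvd N" "c \<in> {1, D}" for c w
  proof -
    have "3 dvd c * w ^ 2 mod 3" using that by simp
    moreover have "c * w ^ 2 mod 3 = c * (w ^ 2 mod 3) mod 3" by (simp add: mod_mult_right_eq)
    ultimately show ?thesis using that(3) D'(4) by (auto simp: square_mod_3 split: if_splits)
  qed
  have "N mod 3 = 1 \<or> N mod 3 = 2 \<or> 3 dvd N" by presburger
  then consider "N mod 3 = 1" | "N mod 3 = 2" | "3 dvd N" "\<not> 9 dvd N" | M where "N = 9 * M"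
    by (auto elim: dvdE)
  thus ?case
  proof cases
    case 1
    have "D * w ^ 2 \<noteq> N" for w
    proof
      assume "D * w ^ 2 = N"
      hence "D * (w ^ 2 mod 3) mod 3 = 1" using 1 by (simp add: mod_mult_right_eq)
      thus False using D'(4) by (auto simp: square_mod_3 split: if_splits)
    qed
    thus ?thesis using odd_card_reps_coprime_3[of 1 D N] D' 1 by simp
  next
    case 2
    have "w ^ 2 \<noteq> N" for w
      using 2 by (auto simp: square_mod_3 split: if_splits)
    thus ?thesis using odd_card_reps_coprime_3[of D 1 N] D' 2 card_reps_swap[of 1 D] by simp
  next
    case 3
    have "9 dvd N" if c: "c * w ^ 2 = N" "c \<in> {1, D}" for c w
    proof -
      obtain k where "w = 3 * k" using dvd[OF c(1) \<open>3 dvd N\<close> c(2)] by blast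
      thus ?thesis using c by (auto simp: power2_eq_square)
    qed
    from this[of 1] this[of D] show ?thesis
      using even_card_reps_exactly_3[OF ab 3 less.prems(2)] 3(2) by auto
  next
    case 4
    have iff: "(\<exists>w. c * w ^ 2 = N) \<longleftrightarrow> (\<exists>w. c * w ^ 2 = M)" if c: "c \<in> {1, D}" for c
    proof
      assume "\<exists>w. c * w ^ 2 = N"
      then obtain w where w: "c * w ^ 2 = N" by blast
      then obtain k where "w = 3 * k" using dvd[of c w] 4 c by auto
      thus "\<exists>w. c * w ^ 2 = M" using w 4 by (auto simp: power2_eq_square)
    next
      assume "\<exists>w. c * w ^ 2 = M"
      then obtain w where "c * w ^ 2 = M" by blast
      hence "c * (3 * w) ^ 2 = N" using 4 by (simp add: power2_eq_square)
      thus "\<exists>w. c * w ^ 2 = N" by blast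
    qed
    have M: "M > 0" "M mod 4 = 1" using 4 less.prems by presburger+
    hence "nat M < nat N" using 4 by simp
    from less.hyps[OF this M] show ?thesis
      using iff[of 1] iff[of D] card_reps_9[OF ab, of M] 4 by simp
  qed
qed

section \<open>Even and odd parts of power series over the field with two elements\<close>

unbundle fps_syntax

lemma add_self_bit: "x + x = (0 :: bit)"
  by (cases x) simp_all

text \<open>
  In a coefficient of a square the terms with indices \<open>i\<close> and \<open>n - i\<close> cancel in characteristic 2; only
  the middle term survives, if there is one.
\<close>
lemma bit_fps_square_even_nth: "(F ^ 2) $ (2 * n) = F $ n" for F :: "bit fps"
proof -
  have "(F ^ 2) $ (2 * n) = (\<Sum>i\<in>{0..2*n}. F $ i * F $ (2 * n - i))"
    by (simp add: power2_eq_square fps_mult_nth)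
  also have "\<dots> = F $ n * F $ n + (\<Sum>i\<in>{0..2*n} - {n}. F $ i * F $ (2 * n - i))"
    by (subst sum.remove[of _ n]) auto
  also have "(\<Sum>i\<in>{0..2*n} - {n}. F $ i * F $ (2 * n - i)) = 0"
    by (rule sum_involution_eq_0[where h = "\<lambda>i. 2 * n - i"])
       (auto simp: add_self_bit mult.commute)
  also have "F $ n * F $ n + 0 = F $ n"
    by (cases "F $ n") auto
  finally show ?thesis .
qed

lemma bit_fps_square_odd_nth: "(F ^ 2) $ (2 * n + 1) = 0" for F :: "bit fps"
proof -
  have "(F ^ 2) $ (2 * n + 1) = (\<Sum>i\<in>{0..2*n+1}. F $ i * F $ (2 * n + 1 - i))"
    by (simp add: power2_eq_square fps_mult_nth)
  also have "\<dots> = 0"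
    by (rule sum_involution_eq_0[where h = "\<lambda>i. 2 * n + 1 - i"])
       (auto simp: add_self_bit mult.commute, presburger)
  finally show ?thesis .
qed

lemma bit_fps_dissection_nth:
  fixes Y Z :: "bit fps"
  shows "(Y ^ 2 + fps_X * Z ^ 2) $ (2 * n) = Y $ n"
    and "(Y ^ 2 + fps_X * Z ^ 2) $ (2 * n + 1) = Z $ n"
proof -
  show "(Y ^ 2 + fps_X * Z ^ 2) $ (2 * n) = Y $ n"
  proof (cases n)
    case (Suc m)
    have "(Z ^ 2) $ (2 * n - 1) = 0" using bit_fps_square_odd_nth[of Z m] Suc by simp
    thus ?thesis by (simp add: bit_fps_square_even_nth)
  qed (use bit_fps_square_even_nth[of Y 0] in simp)
  show "(Y ^ 2 + fps_X * Z ^ 2) $ (2 * n + 1) = Z $ n"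
    using bit_fps_square_odd_nth[of Y n] bit_fps_square_even_nth[of Z n] by simp
qed

lemma bit_fps_eqI_dissection:
  fixes F G :: "bit fps"
  assumes "\<And>n. F $ (2 * n) = G $ (2 * n)" "\<And>n. F $ (2 * n + 1) = G $ (2 * n + 1)"
  shows "F = G"
proof (rule fps_ext)
  fix n
  show "F $ n = G $ n"
  proof (cases "even n")
    case True
    thus ?thesis using assms(1)[of "n div 2"] by simp
  next
    case False
    hence "n = 2 * (n div 2) + 1" by presburger
    thus ?thesis using assms(2)[of "n div 2"] by metis
  qed
qed

section \<open>Theta series modulo 2\<close>

text \<open>
  The reduction of \<open>f\<^sub>c\<close> modulo 2: the generalised pentagonal numbers are the numbers
  \<open>(x\<^sup>2 - 1) / 24\<close> with \<open>x\<close> congruent to 1 modulo 6. The condition is stated without division, which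
  makes products of such series count solutions of diagonal quadratic equations.
\<close>
definition theta :: "int \<Rightarrow> bit fps" where
  "theta c = Abs_fps (\<lambda>n. of_bool (\<exists>x. x mod 6 = 1 \<and> c * x ^ 2 = 24 * int n + c))"

text \<open>
  For odd \<open>c > 0\<close> this is the sum of \<open>q\<^bsup>cn(n+1)/2\<^esup>\<close> over \<open>n \<ge> 0\<close>: an integer \<open>w\<close> satisfying the equation is odd,
  and \<open>(w\<^sup>2 - 1) / 8\<close> is a triangular number.
\<close>
definition triangular :: "int \<Rightarrow> bit fps" where
  "triangular c = Abs_fps (\<lambda>n. of_bool (\<exists>w. c * w ^ 2 = 8 * int n + c))"

lemma square_1_mod_6:
  assumes "x mod 6 = (1 :: int)"
  obtains k where "x ^ 2 = 24 * k + 1" "k \<ge> 0"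
proof -
  obtain j where j: "x = 6 * j + 1" using assms by (metis mult_div_mod_eq)
  have "even (j * (3 * j + 1))" by auto
  then obtain k where k: "j * (3 * j + 1) = 2 * k" by blast
  have x: "x ^ 2 = 24 * k + 1"
    using k by (simp add: j power2_eq_square algebra_simps)
  moreover have "k \<ge> 0" using x zero_le_power2[of x] by linarith
  ultimately show ?thesis using that by blast
qed

lemma square_odd:
  assumes "odd (x :: int)"
  obtains k where "x ^ 2 = 8 * k + 1" "k \<ge> 0"
proof -
  obtain j where j: "x = 2 * j + 1" using assms by (elim oddE)
  have "even (j * (j + 1))" by auto
  then obtain k where k: "j * (j + 1) = 2 * k" by blast
  have x: "x ^ 2 = 8 * k + 1"
    using k by (simp add: j power2_eq_square algebra_simps)
  moreover have "k \<ge> 0" using x zero_le_power2[of x] by linarith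
  ultimately show ?thesis using that by blast
qed

lemma eq_if_1_mod_6: "x ^ 2 = y ^ 2 \<Longrightarrow> x mod 6 = 1 \<Longrightarrow> y mod 6 = 1 \<Longrightarrow> x = y" for x y :: int
proof -
  assume "x ^ 2 = y ^ 2" and xy: "x mod 6 = 1" "y mod 6 = 1"
  hence "x = y \<or> x = - y" by (simp add: power2_eq_iff)
  thus "x = y" using xy by presburger
qed

lemma theta_power2:
  assumes "c > 0"
  shows "theta c ^ 2 = theta (2 * c)"
proof (rule bit_fps_eqI_dissection)
  fix n
  have "2 * c * x ^ 2 = 24 * int (2 * n) + 2 * c \<longleftrightarrow> c * x ^ 2 = 24 * int n + c" for x
    by (simp add: mult.assoc) linarith
  thus "(theta c ^ 2) $ (2 * n) = theta (2 * c) $ (2 * n)"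
    by (simp only: bit_fps_square_even_nth theta_def fps_nth_Abs_fps)
  have "\<not> (x mod 6 = 1 \<and> 2 * c * x ^ 2 = 24 * int (2 * n + 1) + 2 * c)" for x
  proof
    assume x: "x mod 6 = 1 \<and> 2 * c * x ^ 2 = 24 * int (2 * n + 1) + 2 * c"
    then obtain k where k: "x ^ 2 = 24 * k + 1" using square_1_mod_6 by blast
    have "2 * (c * k) = 2 * int n + 1" using x by (simp add: k algebra_simps)
    thus False by presburger
  qed
  thus "(theta c ^ 2) $ (2 * n + 1) = theta (2 * c) $ (2 * n + 1)"
    by (simp only: bit_fps_square_odd_nth theta_def fps_nth_Abs_fps) simp
qed

definition theta_pairs :: "int \<Rightarrow> int \<Rightarrow> int \<Rightarrow> (int \<times> int) set" where
  "theta_pairs c d N = {(x, y). x mod 6 = 1 \<and> y mod 6 = 1 \<and> c * x ^ 2 + d * y ^ 2 = N}"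

lemma theta_mult_nth:
  assumes c: "c > 0" and d: "d > 0"
  shows "(theta c * theta d) $ n = of_nat (card (theta_pairs c d (24 * int n + c + d)))"
proof -
  define P where "P = (\<lambda>c i. \<exists>x. x mod 6 = 1 \<and> c * x ^ 2 = 24 * int i + c)"
  let ?I = "{i \<in> {0..n}. P c i \<and> P d (n - i)}"
  let ?f = "\<lambda>(x, y). nat (c * (x ^ 2 - 1) div 24)"
  have f: "c * x ^ 2 = 24 * int (?f (x, y)) + c \<and> d * y ^ 2 = 24 * int (n - ?f (x, y)) + d \<and> ?f (x, y) \<le> n"
    if "(x, y) \<in> theta_pairs c d (24 * int n + c + d)" for x y
  proof -
    have xy: "x mod 6 = 1" "y mod 6 = 1" "c * x ^ 2 + d * y ^ 2 = 24 * int n + c + d"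
      using that by (auto simp: theta_pairs_def)
    obtain k where k: "x ^ 2 = 24 * k + 1" "k \<ge> 0" using square_1_mod_6[OF xy(1)] .
    obtain l where l: "y ^ 2 = 24 * l + 1" "l \<ge> 0" using square_1_mod_6[OF xy(2)] .
    have n: "int n = c * k + d * l" using xy(3) by (simp add: k l algebra_simps)
    have "c * (x ^ 2 - 1) = 24 * (c * k)" by (simp add: k)
    hence fxy: "int (?f (x, y)) = c * k" using c k by simp
    moreover have "d * l \<ge> 0" using d l by simp
    ultimately have le: "?f (x, y) \<le> n" using n by linarith
    hence "int (n - ?f (x, y)) = d * l" using n fxy by (simp only: of_nat_diff)
    thus ?thesis using le fxy by (simp only: k l) (simp add: algebra_simps)
  qed
  have "bij_betw ?f (theta_pairs c d (24 * int n + c + d)) ?I"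
  proof (rule bij_betw_imageI)
    show "inj_on ?f (theta_pairs c d (24 * int n + c + d))"
    proof (rule inj_onI)
      fix p q assume p: "p \<in> theta_pairs c d (24 * int n + c + d)"
        and q: "q \<in> theta_pairs c d (24 * int n + c + d)" and eq: "?f p = ?f q"
      obtain x y x' y' where [simp]: "p = (x, y)" "q = (x', y')" by (cases p, cases q)
      have "c * x ^ 2 = c * x' ^ 2" "d * y ^ 2 = d * y' ^ 2"
        using f[of x y] f[of x' y'] p q eq unfolding \<open>p = (x, y)\<close> \<open>q = (x', y')\<close> by metis+
      hence "x ^ 2 = x' ^ 2" "y ^ 2 = y' ^ 2" using c d by simp_all
      thus "p = q" using p q by (auto simp: theta_pairs_def intro: eq_if_1_mod_6)
    qed
    show "?f ` theta_pairs c d (24 * int n + c + d) = ?I"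
    proof (intro equalityI subsetI)
      fix i assume "i \<in> ?f ` theta_pairs c d (24 * int n + c + d)"
      then obtain p where "i = ?f p" "p \<in> theta_pairs c d (24 * int n + c + d)" by blast
      moreover obtain x y where "p = (x, y)" by (cases p)
      ultimately have i: "i = ?f (x, y)" and xy: "(x, y) \<in> theta_pairs c d (24 * int n + c + d)"
        by simp_all
      have "x mod 6 = 1" "y mod 6 = 1" using xy by (auto simp: theta_pairs_def)
      moreover have "c * x ^ 2 = 24 * int i + c" "d * y ^ 2 = 24 * int (n - i) + d" "i \<le> n"
        using f[OF xy] unfolding i by blast+
      ultimately show "i \<in> ?I" unfolding P_def by auto
    next
      fix i assume i: "i \<in> ?I"
      then obtain x y where x: "x mod 6 = 1" "c * x ^ 2 = 24 * int i + c"
        and y: "y mod 6 = 1" "d * y ^ 2 = 24 * int (n - i) + d" unfolding P_def by blast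
      have "c * (x ^ 2 - 1) = 24 * int i" using x by (simp add: algebra_simps)
      hence "i = ?f (x, y)" by simp
      moreover have "(x, y) \<in> theta_pairs c d (24 * int n + c + d)"
        using x y i by (auto simp: theta_pairs_def of_nat_diff)
      ultimately show "i \<in> ?f ` theta_pairs c d (24 * int n + c + d)" by blast
    qed
  qed
  hence card: "card (theta_pairs c d (24 * int n + c + d)) = card ?I"
    by (rule bij_betw_same_card)
  have "(theta c * theta d) $ n = (\<Sum>i\<in>{0..n}. of_bool (P c i \<and> P d (n - i)))"
    unfolding fps_mult_nth by (rule sum.cong) (auto simp: theta_def P_def)
  also have "\<dots> = of_nat (card ({0..n} \<inter> {i. P c i \<and> P d (n - i)}))"
    by (subst sum_of_bool_eq) auto
  also have "{0..n} \<inter> {i. P c i \<and> P d (n - i)} = ?I" by blast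
  finally show ?thesis unfolding card .
qed

text \<open>
  The correspondence is \<open>x + y\<surd>-D = (1 + \<surd>-D) (u + v\<surd>-D)\<close>; the factor has norm \<open>D + 1\<close>. The condition
  \<open>N mod 4 = 1\<close> forces \<open>u + v\<close> to be odd, and \<open>v\<close> to be even when \<open>D = 2\<close>, which lifts the congruence
  modulo 3 on one side to the congruences modulo 6 on the other.
\<close>
lemma card_theta_pairs:
  assumes D: "D \<in> {2, 5}" and N: "N mod 4 = 1"
  shows "card (theta_pairs 1 D ((D + 1) * N)) = card (reps 1 D N)"
proof (rule bij_betw_same_card[symmetric])
  define f where "f = (\<lambda>(u, v). (u - D * v, u + v))"
  define f' where "f' = (\<lambda>(x, y). ((x + D * y) div (D + 1), (y - x) div (D + 1)))"
  show "bij_betw f (reps 1 D N) (theta_pairs 1 D ((D + 1) * N))"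
  proof (rule bij_betw_byWitness[of _ f'])
    have q: "u - D * v + D * (u + v) = (D + 1) * u" "u + v - (u - D * v) = (D + 1) * v" for u v
      by (simp_all add: algebra_simps)
    have "D + 1 \<noteq> 0" using D by auto
    thus "\<forall>p\<in>reps 1 D N. f' (f p) = p"
      by (auto simp: f_def f'_def q)
    show "f ` reps 1 D N \<subseteq> theta_pairs 1 D ((D + 1) * N)"
    proof (rule image_subsetI)
      fix p assume "p \<in> reps 1 D N"
      moreover obtain u v where [simp]: "p = (u, v)" by (cases p)
      ultimately have uv: "u ^ 2 + D * v ^ 2 = N" "(u + v) mod 3 = 1" by (auto simp: reps_def)
      have "(u ^ 2 mod 4 + D * (v ^ 2 mod 4)) mod 4 = 1"
        using N uv(1) by (metis mod_add_eq mod_mult_right_eq mod_mod_trivial)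
      hence par: "odd (u + v) \<and> (D = 2 \<longrightarrow> even v)"
        using D by (auto simp: square_mod_4 split: if_splits)
      have mod6: "x mod 6 = 1" if "x mod 3 = 1" "odd x" for x :: int
        using that by presburger
      have "(u + v) mod 6 = 1" using par uv(2) mod6 by blast
      moreover have "(u - D * v) mod 6 = 1"
      proof -
        obtain j where "u - D * v = u + v + 6 * j"
        proof (cases "D = 2")
          case True
          then obtain i where "v = 2 * i" using par by blast
          hence "u - D * v = u + v + 6 * (- i)" using True by simp
          thus ?thesis by (rule that)
        next
          case False
          hence "u - D * v = u + v + 6 * (- v)" using D by simp
          thus ?thesis by (rule that)
        qed
        thus ?thesis using \<open>(u + v) mod 6 = 1\<close> by (simp only: mod_mult_self2)
      qed
      moreover have "(u - D * v) ^ 2 + D * (u + v) ^ 2 = (D + 1) * N"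
        unfolding uv(1)[symmetric] by (simp add: power2_eq_square algebra_simps)
      ultimately show "f p \<in> theta_pairs 1 D ((D + 1) * N)"
        by (simp add: f_def theta_pairs_def)
    qed
    have *: "f (f' (x, y)) = (x, y) \<and> f' (x, y) \<in> reps 1 D N"
      if "(x, y) \<in> theta_pairs 1 D ((D + 1) * N)" for x y
    proof -
      have xy: "x ^ 2 + D * y ^ 2 = (D + 1) * N" "x mod 6 = 1" "y mod 6 = 1"
        using that by (auto simp: theta_pairs_def)
      then obtain s t where st: "x = 6 * s + 1" "y = 6 * t + 1"
        by (metis mult_div_mod_eq)
      have "D = 2 \<or> D = 5" using D by simp
      then obtain m :: int where m: "D = 2 \<and> m = 2 \<or> D = 5 \<and> m = 1" by blast
      have "x + D * y = (D + 1) * (m * (s + D * t) + 1)" "y - x = (D + 1) * (m * (t - s))"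
        using m by (auto simp: st algebra_simps)
      hence f': "f' (x, y) = (m * (s + D * t) + 1, m * (t - s))"
        by (simp only: f'_def prod.case nonzero_mult_div_cancel_left[OF \<open>D + 1 \<noteq> 0\<close>])
      have ff: "f (f' (x, y)) = (x, y)"
        unfolding f' using m by (auto simp: f_def st algebra_simps)
      have "m * (s + D * t) + 1 + m * (t - s) = 3 * (2 * t) + 1"
        using m by (auto simp: algebra_simps)
      hence "(m * (s + D * t) + 1 + m * (t - s)) mod 3 = 1" by presburger
      moreover have "(D + 1) * ((m * (s + D * t) + 1) ^ 2 + D * (m * (t - s)) ^ 2) = (D + 1) * N"
        unfolding xy(1)[symmetric] st using m by (auto simp: power2_eq_square algebra_simps)
      hence "(m * (s + D * t) + 1) ^ 2 + D * (m * (t - s)) ^ 2 = N"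
        using \<open>D + 1 \<noteq> 0\<close> by (metis mult_left_cancel)
      ultimately show ?thesis using ff unfolding f' by (simp add: reps_def)
    qed
    show "\<forall>p\<in>theta_pairs 1 D ((D + 1) * N). f (f' p) = p"
      "f' ` theta_pairs 1 D ((D + 1) * N) \<subseteq> reps 1 D N"
      using * by auto
  qed
qed

lemma of_nat_bit: "(of_nat n :: bit) = of_bool (odd n)"
  by (cases "even n") (auto elim!: evenE oddE)

text \<open>
  Modulo 2 this says \<open>f\<^sub>c\<^sup>3 = \<Sum>q\<^bsup>cn(n+1)/2\<^esup>\<close>. Of the two ways in which \<open>odd_card_reps\<close> allows an odd count,
  only \<open>N\<close> itself being a square occurs, because \<open>N = 8 m + 1\<close> is odd.
\<close>
lemma theta_mult_theta_double:
  assumes c: "c > 0" "odd c"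
  shows "theta c * theta (2 * c) = triangular c"
proof (rule fps_ext)
  fix n
  have lhs: "(theta c * theta (2 * c)) $ n = of_nat (card (theta_pairs c (2 * c) (24 * int n + c + 2 * c)))"
    using c by (intro theta_mult_nth) auto
  show "(theta c * theta (2 * c)) $ n = triangular c $ n"
  proof (cases "c dvd int n")
    case True
    then obtain m where m: "int n = c * m" by blast
    have "m \<ge> 0" using m c by (metis of_nat_0_le_iff zero_le_mult_iff not_less)
    have div: "c * A + 2 * c * B = 24 * int n + c + 2 * c \<longleftrightarrow> A + 2 * B = 3 * (8 * m + 1)" for A B
    proof -
      have "c * A + 2 * c * B = 24 * int n + c + 2 * c \<longleftrightarrow> c * (A + 2 * B) = c * (3 * (8 * m + 1))"
        unfolding m by (simp add: algebra_simps)
      also have "\<dots> \<longleftrightarrow> A + 2 * B = 3 * (8 * m + 1)" using c by auto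
      finally show ?thesis .
    qed
    have "theta_pairs c (2 * c) (24 * int n + c + 2 * c) = theta_pairs 1 2 ((2 + 1) * (8 * m + 1))"
      unfolding theta_pairs_def div by simp
    hence "card (theta_pairs c (2 * c) (24 * int n + c + 2 * c)) = card (reps 1 2 (8 * m + 1))"
      using card_theta_pairs[of 2 "8 * m + 1"] by (simp, presburger)
    moreover have "odd (card (reps 1 2 (8 * m + 1))) \<longleftrightarrow>
        (\<exists>w. w ^ 2 = 8 * m + 1) \<or> (\<exists>w. 2 * w ^ 2 = 8 * m + 1)"
      using \<open>m \<ge> 0\<close> by (intro odd_card_reps) (auto, presburger)
    moreover have "2 * w ^ 2 \<noteq> 8 * m + 1" for w by presburger
    moreover have "c * w ^ 2 = 8 * int n + c \<longleftrightarrow> w ^ 2 = 8 * m + 1" for w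
    proof -
      have "c * w ^ 2 = 8 * int n + c \<longleftrightarrow> c * w ^ 2 = c * (8 * m + 1)"
        unfolding m by (simp add: algebra_simps)
      thus ?thesis using c by auto
    qed
    ultimately show ?thesis
      unfolding lhs by (simp add: triangular_def of_nat_bit)
  next
    case False
    have "(x, y) \<notin> theta_pairs c (2 * c) (24 * int n + c + 2 * c)" for x y
    proof
      assume "(x, y) \<in> theta_pairs c (2 * c) (24 * int n + c + 2 * c)"
      hence xy: "x mod 6 = 1" "y mod 6 = 1" "c * x ^ 2 + 2 * c * y ^ 2 = 24 * int n + c + 2 * c"
        by (auto simp: theta_pairs_def)
      obtain k where k: "x ^ 2 = 24 * k + 1" using square_1_mod_6[OF xy(1)] .
      obtain l where l: "y ^ 2 = 24 * l + 1" using square_1_mod_6[OF xy(2)] .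
      have "int n = c * (k + 2 * l)" using xy(3) by (simp add: k l algebra_simps)
      thus False using False by simp
    qed
    hence "theta_pairs c (2 * c) (24 * int n + c + 2 * c) = {}" by auto
    moreover have "c * w ^ 2 \<noteq> 8 * int n + c" for w
    proof
      assume w: "c * w ^ 2 = 8 * int n + c"
      have "odd (c * w ^ 2)" unfolding w using c by simp
      hence "odd w" by simp
      then obtain k where "w ^ 2 = 8 * k + 1" using square_odd by blast
      hence "int n = c * k" using w by (simp add: algebra_simps)
      thus False using False by simp
    qed
    ultimately show ?thesis unfolding lhs by (simp add: triangular_def)
  qed
qed

text \<open>
  The identity \<open>f\<^sub>1 f\<^sub>5 = f\<^sub>1\<^sup>6 + q f\<^sub>5\<^sup>6\<close> modulo 2. The coefficient at \<open>n\<close> is 1 exactly if \<open>4 n + 1\<close> is a square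
  or 5 times a square; since odd squares are 1 modulo 8, the first happens only for even \<open>n\<close> and
  the second only for odd \<open>n\<close>.
\<close>
lemma theta_1_mult_theta_5: "theta 1 * theta 5 = triangular 1 ^ 2 + fps_X * triangular 5 ^ 2"
proof -
  have coeff: "(theta 1 * theta 5) $ n =
      of_bool ((\<exists>w. w ^ 2 = 4 * int n + 1) \<or> (\<exists>w. 5 * w ^ 2 = 4 * int n + 1))" for n
  proof -
    have "(theta 1 * theta 5) $ n = of_nat (card (theta_pairs 1 5 ((5 + 1) * (4 * int n + 1))))"
      using theta_mult_nth[of 1 5 n] by (simp add: algebra_simps)
    also have "card (theta_pairs 1 5 ((5 + 1) * (4 * int n + 1))) = card (reps 1 5 (4 * int n + 1))"
      by (rule card_theta_pairs) (simp, presburger)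
    finally show ?thesis
      using odd_card_reps[of 5 "4 * int n + 1"] by (simp add: of_nat_bit)
  qed
  have odd: "odd w" if "w ^ 2 = 2 * r + 1 \<or> 5 * w ^ 2 = 2 * r + 1" for w r :: int
  proof
    assume "even w"
    then obtain j where "w = 2 * j" by blast
    hence "w ^ 2 = 2 * (2 * j ^ 2)" by (simp add: power2_eq_square)
    thus False using that by presburger
  qed
  have not5: "5 * w ^ 2 \<noteq> 8 * m + 1" for w m :: int
  proof
    assume eq: "5 * w ^ 2 = 8 * m + 1"
    hence "odd w" using odd[of w "4 * m"] by simp
    then obtain k where "w ^ 2 = 8 * k + 1" using square_odd by blast
    thus False using eq by presburger
  qed
  have not1: "w ^ 2 \<noteq> 8 * m + 5" for w m :: int
  proof
    assume eq: "w ^ 2 = 8 * m + 5"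
    hence "odd w" using odd[of w "4 * m + 2"] by simp
    then obtain k where "w ^ 2 = 8 * k + 1" using square_odd by blast
    thus False using eq by presburger
  qed
  show ?thesis
  proof (rule bit_fps_eqI_dissection)
    fix n
    show "(theta 1 * theta 5) $ (2 * n) = (triangular 1 ^ 2 + fps_X * triangular 5 ^ 2) $ (2 * n)"
      unfolding coeff bit_fps_dissection_nth using not5[of _ "int n"] by (simp add: triangular_def)
    have "4 * int (2 * n + 1) + 1 = 8 * int n + 5" by simp
    thus "(theta 1 * theta 5) $ (2 * n + 1) = (triangular 1 ^ 2 + fps_X * triangular 5 ^ 2) $ (2 * n + 1)"
      unfolding coeff bit_fps_dissection_nth using not1[of _ "int n"] by (simp only: triangular_def fps_nth_Abs_fps) simp
  qed
qed

text \<open>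
  With \<open>A = f\<^sub>1\<close>, \<open>D = f\<^sub>5\<close> and \<open>A D = A\<^sup>6 + q D\<^sup>6\<close>, multiplication by squares of \<open>1/A\<close> and \<open>1/D\<close> gives
  \<open>1/(A\<^sup>3 D) = (A/D)\<^sup>2 + q (D\<^sup>2/A\<^sup>2)\<^sup>2\<close>, then \<open>A/D = (A\<^sup>3/D)\<^sup>2 + q (D\<^sup>2)\<^sup>2\<close> and
  \<open>A\<^sup>3/D = (A\<^sup>4/D)\<^sup>2 + q (A D\<^sup>2)\<^sup>2\<close>. Taking the even, even and odd part in turn extracts the
  exponents \<open>2 (2 (2 m + 1)) = 8 m + 4\<close>.
\<close>
lemma bracelet_series_coeff:
  fixes B :: "bit fps"
  assumes B: "B * (theta 1 ^ 3 * theta 5) = 1"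
  shows "B $ (8 * m + 4) = (theta 1 * theta 10) $ m"
proof -
  define A where "A = theta 1"
  define D where "D = theta 5"
  \<comment> \<open>The inverses of \<open>A\<close> and \<open>D\<close>, read off from the inverse \<open>B\<close> of \<open>A\<^sup>3 D\<close>.\<close>
  define I where "I = B * A ^ 2 * D"
  define J where "J = B * A ^ 3"
  have "A ^ 2 = theta 2" "D ^ 2 = theta 10"
    using theta_power2[of 1] theta_power2[of 5] by (simp_all add: A_def D_def)
  hence "A ^ 3 = triangular 1" "D ^ 3 = triangular 5"
    using theta_mult_theta_double[of 1] theta_mult_theta_double[of 5]
    by (simp_all add: A_def D_def power3_eq_cube power2_eq_square mult.commute)
  hence AD: "A * D = (A ^ 3) ^ 2 + fps_X * (D ^ 3) ^ 2"
    using theta_1_mult_theta_5 by (simp add: A_def D_def)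
  have B': "B * A ^ 3 * D = 1" using B by (simp add: A_def D_def mult.assoc)
  have I: "A * I = 1" and J: "D * J = 1" using B' unfolding I_def J_def by algebra+
  have "B = A * D * (I ^ 2 * J) ^ 2" using B' I J by algebra
  also have "\<dots> = (A * J) ^ 2 + fps_X * (I ^ 2 * D ^ 2) ^ 2"
    unfolding AD using I J by algebra
  finally have B_even: "B $ (2 * n) = (A * J) $ n" for n
    by (simp only: bit_fps_dissection_nth)
  have "A * J = A * D * J ^ 2" using J by algebra
  hence "A * J = (A ^ 3 * J) ^ 2 + fps_X * (D ^ 2) ^ 2"
    unfolding AD using J by algebra
  hence AJ_even: "(A * J) $ (2 * n) = (A ^ 3 * J) $ n" for n
    by (simp only: bit_fps_dissection_nth)
  have "A ^ 3 * J = A * D * (A * J) ^ 2" using J by algebra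
  hence "A ^ 3 * J = (A ^ 4 * J) ^ 2 + fps_X * (A * D ^ 2) ^ 2"
    unfolding AD using J by algebra
  hence A3J_odd: "(A ^ 3 * J) $ (2 * n + 1) = (A * D ^ 2) $ n" for n
    by (simp only: bit_fps_dissection_nth)
  have "8 * m + 4 = 2 * (2 * (2 * m + 1))" by simp
  hence "B $ (8 * m + 4) = (A * D ^ 2) $ m"
    by (simp only: B_even AJ_even A3J_odd)
  thus ?thesis using \<open>D ^ 2 = theta 10\<close> by (simp add: A_def)
qed

section \<open>Numbers not represented by x^2 + 10 y^2\<close>

text \<open>
  If 25 divides \<open>x\<^sup>2 + 10 y\<^sup>2\<close>, then 5 divides first \<open>x\<close> and consequently \<open>y\<close>.
\<close>
lemma form_1_10_descent:
  fixes x y M :: int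
  assumes "x ^ 2 + 10 * y ^ 2 = 25 ^ k * M"
  shows "\<exists>x y. x ^ 2 + 10 * y ^ 2 = M"
  using assms
proof (induction k arbitrary: x y)
  case (Suc k)
  have "5 dvd x ^ 2 + 10 * y ^ 2" unfolding Suc.prems by simp
  hence "5 dvd x ^ 2" by presburger
  hence "5 dvd x" using prime_dvd_power[of 5 x 2] by simp
  then obtain x' where x: "x = 5 * x'" by blast
  have "5 * (5 * x' ^ 2 + 2 * y ^ 2) = 5 * (5 * (25 ^ k * M))"
    using Suc.prems by (simp add: x power2_eq_square)
  hence "5 * x' ^ 2 + 2 * y ^ 2 = 5 * (25 ^ k * M)" by simp
  hence "5 dvd y ^ 2" by presburger
  hence "5 dvd y" using prime_dvd_power[of 5 y 2] by simp
  then obtain y' where y: "y = 5 * y'" by blast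
  have "x' ^ 2 + 10 * y' ^ 2 = 25 ^ k * M"
    using Suc.prems by (simp add: x y power2_eq_square)
  thus ?case by (rule Suc.IH)
qed auto

lemma square_mod_5: "(x ^ 2) mod 5 \<in> {0, 1, 4}" for x :: int
proof -
  have "x mod 5 \<in> {0, 1, 2, 3, 4}" by (simp, presburger)
  hence "(x mod 5) ^ 2 mod 5 \<in> {0, 1, 4}" by auto
  thus ?thesis by (simp add: power_mod)
qed

lemma form_1_10_not_rep:
  fixes x y M :: int
  shows "M mod 5 \<in> {2, 3} \<Longrightarrow> x ^ 2 + 10 * y ^ 2 \<noteq> 25 ^ k * M"
    and "M mod 5 \<in> {1, 4} \<Longrightarrow> x ^ 2 + 10 * y ^ 2 \<noteq> 25 ^ k * (5 * M)"
proof -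
  show "x ^ 2 + 10 * y ^ 2 \<noteq> 25 ^ k * M" if "M mod 5 \<in> {2, 3}"
  proof
    assume "x ^ 2 + 10 * y ^ 2 = 25 ^ k * M"
    then obtain x y :: int where "x ^ 2 + 10 * y ^ 2 = M" using form_1_10_descent by blast
    hence "M = x ^ 2 + 5 * (2 * y ^ 2)" by simp
    hence "M mod 5 = x ^ 2 mod 5" by (simp only: mod_mult_self2)
    thus False using square_mod_5[of x] that by auto
  qed
  show "x ^ 2 + 10 * y ^ 2 \<noteq> 25 ^ k * (5 * M)" if "M mod 5 \<in> {1, 4}"
  proof
    assume "x ^ 2 + 10 * y ^ 2 = 25 ^ k * (5 * M)"
    then obtain x y :: int where xy: "x ^ 2 + 10 * y ^ 2 = 5 * M" using form_1_10_descent by blast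
    hence "5 dvd x ^ 2" by presburger
    hence "5 dvd x" using prime_dvd_power[of 5 x 2] by simp
    then obtain x' where x: "x = 5 * x'" by blast
    have "M = 2 * y ^ 2 + 5 * x' ^ 2" using xy by (simp add: x power2_eq_square)
    hence "M mod 5 = 2 * (y ^ 2 mod 5) mod 5" by (simp only: mod_mult_self2 mod_mult_right_eq)
    thus False using square_mod_5[of y] that by auto
  qed
qed

section \<open>The pentagonal number theorem\<close>

definition tri :: "nat \<Rightarrow> nat" where
  "tri k = (\<Sum>i\<le>k. i)"

lemma tri_simps [simp]: "tri 0 = 0" "tri (Suc k) = tri k + Suc k"
  by (simp_all add: tri_def)

text \<open>
  For fixed \<open>n\<close> the term with \<open>k = 0\<close> is the finite Euler product, while all the others are
  divisible by \<open>q\<^bsup>n\<^esup>\<close>. Shanks observed that nevertheless their sum over \<open>k \<le> n\<close> is exactly a partial sum of the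
  pentagonal number series.
\<close>
definition shanks_term :: "'a :: comm_ring_1 \<Rightarrow> nat \<Rightarrow> nat \<Rightarrow> 'a" where
  "shanks_term q n k = (-1) ^ k * (\<Prod>j=Suc k..n. 1 - q ^ j) * q ^ (k * n + tri k)"

text \<open>
  Passing from \<open>n\<close> to \<open>n + 1\<close> changes the \<open>k\<close>-th term by \<open>U\<^bsub>k-1\<^esub> - U\<^bsub>k\<^esub>\<close>, where \<open>-U\<^bsub>m\<^esub>\<close> is the right-hand side.
\<close>
lemma shanks_term_telescope:
  "m \<le> n \<Longrightarrow> (\<Sum>k\<le>m. shanks_term q (Suc n) k - shanks_term q n k) =
     - ((-1) ^ m * (\<Prod>j=Suc m..n. 1 - q ^ j) * q ^ (tri m + Suc m * Suc n))"
proof (induction m)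
  case 0
  thus ?case by (simp add: shanks_term_def algebra_simps)
next
  case (Suc m)
  define R where "R = (\<Prod>j=Suc (Suc m)..n. 1 - q ^ j)"
  have R1: "(\<Prod>j=Suc m..n. 1 - q ^ j) = (1 - q ^ Suc m) * R"
    using Suc.prems unfolding R_def by (rule prod.atLeast_Suc_atMost)
  have R2: "(\<Prod>j=Suc (Suc m)..Suc n. 1 - q ^ j) = R * (1 - q ^ Suc n)"
    using Suc.prems unfolding R_def by (subst prod.nat_ivl_Suc') (simp_all add: mult.commute)
  define x y z where "x = q ^ Suc m" "y = q ^ Suc n" "z = q ^ (Suc m * n)"
  have e1: "q ^ (tri m + Suc m * Suc n) = q ^ tri m * (z * x)"
    and e2: "q ^ (Suc m * Suc n + tri (Suc m)) = q ^ tri m * x * (z * x)"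
    and e3: "q ^ (Suc m * n + tri (Suc m)) = q ^ tri m * x * z"
    and e4: "q ^ (tri (Suc m) + Suc (Suc m) * Suc n) = q ^ tri m * x * (z * x * y)"
    unfolding x_y_z_def power_add [symmetric] by (intro arg_cong[of _ _ "(^) q"]; simp add: algebra_simps)+
  have "(\<Sum>k\<le>Suc m. shanks_term q (Suc n) k - shanks_term q n k) =
      - ((-1) ^ m * ((1 - x) * R) * (q ^ tri m * (z * x))) +
      ((-1) ^ Suc m * (R * (1 - y)) * (q ^ tri m * x * (z * x)) -
       (-1) ^ Suc m * R * (q ^ tri m * x * z))"
    using Suc unfolding shanks_term_def sum.atMost_Suc R1 R2 R_def[symmetric] e1 e2 e3
    by (simp add: x_y_z_def)
  also have "\<dots> = - ((-1) ^ Suc m * R * (q ^ tri m * x * (z * x * y)))"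
    by (simp add: algebra_simps)
  finally show ?case unfolding R_def[symmetric] e4 .
qed

definition pent :: "int \<Rightarrow> nat" where
  "pent j = nat (j * (3 * j + 1) div 2)"

lemma two_pent: "2 * int (pent j) = j * (3 * j + 1)"
proof -
  have "even (j * (3 * j + 1))" by auto
  moreover have "0 \<le> j * (3 * j + 1)"
    by (cases "j \<ge> 0") (auto intro: mult_nonneg_nonneg mult_nonpos_nonpos)
  ultimately show ?thesis by (simp add: pent_def)
qed

lemma two_tri: "2 * int (tri k) = int k * (int k + 1)"
  by (induction k) (simp_all add: algebra_simps)

lemma pent_int: "pent (int k) = k * k + tri k"
  and pent_minus_int: "pent (- int (Suc k)) = Suc k * Suc k + tri k"
proof -
  have "2 * int (pent (int k)) = 2 * int (k * k + tri k)"
    using two_tri[of k] unfolding two_pent by (simp add: algebra_simps)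
  thus "pent (int k) = k * k + tri k" by (metis mult_cancel_left of_nat_eq_iff zero_neq_numeral)
  have "2 * int (pent (- int (Suc k))) = 2 * int (Suc k * Suc k + tri k)"
    using two_tri[of k] unfolding two_pent by (simp add: algebra_simps)
  thus "pent (- int (Suc k)) = Suc k * Suc k + tri k" by (metis mult_cancel_left of_nat_eq_iff zero_neq_numeral)
qed

text \<open>
  In the step from \<open>n\<close> to \<open>n + 1\<close> the telescoped differences contribute the pentagonal number
  with index \<open>-(n + 1)\<close>, and the new last term contributes the one with index \<open>n + 1\<close>.
\<close>
lemma finite_pentagonal_identity:
  "(\<Sum>k\<le>n. shanks_term q n k) = (\<Sum>j=-int n..int n. (-1) ^ nat \<bar>j\<bar> * q ^ pent j)"
proof (induction n)
  case 0
  thus ?case by (simp add: shanks_term_def pent_def)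
next
  case (Suc n)
  have "(\<Sum>k\<le>Suc n. shanks_term q (Suc n) k) =
      (\<Sum>k\<le>n. shanks_term q n k) + (\<Sum>k\<le>n. shanks_term q (Suc n) k - shanks_term q n k) +
      shanks_term q (Suc n) (Suc n)"
    by (simp add: sum_subtractf)
  also have "(\<Sum>k\<le>n. shanks_term q (Suc n) k - shanks_term q n k) =
      (-1) ^ Suc n * q ^ pent (- int (Suc n))"
    unfolding pent_minus_int by (subst shanks_term_telescope) (simp_all add: add.commute)
  also have "shanks_term q (Suc n) (Suc n) = (-1) ^ Suc n * q ^ pent (int (Suc n))"
    unfolding pent_int by (simp add: shanks_term_def)
  also have "{- int (Suc n)..int (Suc n)} = insert (- int (Suc n)) (insert (int (Suc n)) {- int n..int n})"
    by auto
  hence "(\<Sum>k\<le>n. shanks_term q n k) + (-1) ^ Suc n * q ^ pent (- int (Suc n)) +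
      (-1) ^ Suc n * q ^ pent (int (Suc n)) =
      (\<Sum>j=-int (Suc n)..int (Suc n). (-1) ^ nat \<bar>j\<bar> * q ^ pent j)"
    unfolding Suc.IH by (simp add: nat_add_distrib)
  finally show ?case .
qed

lemma qpoch_inf_LIMSEQ_prod:
  assumes q: "norm q < 1"
  shows "(\<lambda>n. \<Prod>j=1..n. 1 - q ^ j) \<longlonglongrightarrow> qpoch_inf q q"
proof -
  have "abs_convergent_prod (\<lambda>j. 1 + - (q * q ^ j))"
    using q by (intro summable_imp_abs_convergent_prod) (simp add: norm_mult norm_power summable_mult summable_geometric)
  hence "convergent_prod (\<lambda>j. 1 - q * q ^ j)"
    by (simp add: abs_convergent_prod_imp_convergent_prod)
  hence "(\<lambda>n. \<Prod>j\<le>n. 1 - q * q ^ j) \<longlonglongrightarrow> qpoch_inf q q"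
    unfolding qpoch_inf_def by (rule convergent_prod_LIMSEQ)
  hence "(\<lambda>n. \<Prod>j<n. 1 - q * q ^ j) \<longlonglongrightarrow> qpoch_inf q q"
    by (simp add: LIMSEQ_lessThan_iff_atMost)
  also have "(\<lambda>n. \<Prod>j<n. 1 - q * q ^ j) = (\<lambda>n. \<Prod>j=1..n. 1 - q ^ j)"
    by (rule ext, rule prod.reindex_bij_witness[of _ "\<lambda>j. j - 1" Suc]) (auto simp flip: power_Suc)
  finally show ?thesis .
qed

text \<open>
  A bound independent of both ends of the product, so that the terms with \<open>k \<ge> 1\<close> in Shanks'
  identity are uniformly \<open>O(\<bar>q\<bar>\<^bsup>n\<^esup>)\<close>.
\<close>
lemma norm_prod_one_minus_power_le:
  fixes q :: complex
  assumes q: "norm q < 1"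
  shows "norm (\<Prod>j=k..n. 1 - q ^ j) \<le> exp (1 / (1 - norm q))"
proof -
  have "norm (\<Prod>j=k..n. 1 - q ^ j) = (\<Prod>j=k..n. norm (1 - q ^ j))"
    by (rule prod_norm[symmetric])
  also have "\<dots> \<le> (\<Prod>j=k..n. exp (norm q ^ j))"
  proof (rule prod_mono, safe)
    fix j
    have "norm (1 - q ^ j) \<le> 1 + norm q ^ j"
      using norm_triangle_ineq4[of 1 "q ^ j"] by (simp add: norm_power)
    also have "\<dots> \<le> exp (norm q ^ j)" by (rule exp_ge_add_one_self)
    finally show "norm (1 - q ^ j) \<le> exp (norm q ^ j)" .
  qed auto
  also have "\<dots> = exp (\<Sum>j=k..n. norm q ^ j)"
    by (simp add: exp_sum)
  also have "(\<Sum>j=k..n. norm q ^ j) \<le> (\<Sum>j. norm q ^ j)"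
    using q by (intro sum_le_suminf summable_geometric) auto
  also have "(\<Sum>j. norm q ^ j) = 1 / (1 - norm q)"
    using q by (intro suminf_geometric) auto
  finally show ?thesis by simp
qed

lemma pentagonal_LIMSEQ:
  assumes q: "norm q < 1"
  shows "(\<lambda>n. \<Sum>j=-int n..int n. (-1) ^ nat \<bar>j\<bar> * q ^ pent j) \<longlonglongrightarrow> qpoch_inf q q"
proof -
  define C where "C = exp (1 / (1 - norm q))"
  have bound: "norm (shanks_term q n k) \<le> C * norm q ^ n" if k: "k \<in> {1..n}" for n k
  proof -
    have "1 * n \<le> k * n" using k by (intro mult_right_mono) auto
    hence "n \<le> k * n + tri k" by linarith
    hence "norm q ^ (k * n + tri k) \<le> norm q ^ n"
      using q by (intro power_decreasing) auto
    hence "norm (\<Prod>j=Suc k..n. 1 - q ^ j) * norm q ^ (k * n + tri k) \<le> C * norm q ^ n"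
      unfolding C_def using norm_prod_one_minus_power_le[OF q] by (intro mult_mono) auto
    thus ?thesis by (simp add: shanks_term_def norm_mult norm_power)
  qed
  have "(\<lambda>n. \<Sum>k=1..n. shanks_term q n k) \<longlonglongrightarrow> 0"
  proof (rule Lim_null_comparison)
    show "\<forall>\<^sub>F n in sequentially. norm (\<Sum>k=1..n. shanks_term q n k) \<le> C * (of_nat n * norm q ^ n)"
    proof (rule always_eventually, rule allI)
      fix n
      have "norm (\<Sum>k=1..n. shanks_term q n k) \<le> (\<Sum>k=1..n. C * norm q ^ n)"
        by (rule order_trans[OF norm_sum sum_mono]) (rule bound)
      thus "norm (\<Sum>k=1..n. shanks_term q n k) \<le> C * (of_nat n * norm q ^ n)" by (simp add: mult.left_commute)
    qed
    have "(\<lambda>n. of_nat n * norm q ^ n) \<longlonglongrightarrow> 0"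
      using powser_times_n_limit_0[of "norm q"] q by simp
    thus "(\<lambda>n. C * (of_nat n * norm q ^ n)) \<longlonglongrightarrow> 0"
      by (rule tendsto_mult_right_zero)
  qed
  hence "(\<lambda>n. (\<Prod>j=1..n. 1 - q ^ j) + (\<Sum>k=1..n. shanks_term q n k)) \<longlonglongrightarrow> qpoch_inf q q + 0"
    by (intro tendsto_add qpoch_inf_LIMSEQ_prod[OF q])
  moreover have "(\<Prod>j=1..n. 1 - q ^ j) + (\<Sum>k=1..n. shanks_term q n k) =
      (\<Sum>j=-int n..int n. (-1) ^ nat \<bar>j\<bar> * q ^ pent j)" for n
  proof -
    have "{..n} = insert 0 {1..n}" by auto
    thus ?thesis unfolding finite_pentagonal_identity[symmetric]
      by (simp add: shanks_term_def)
  qed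
  ultimately show ?thesis by simp
qed

lemma pent_inj: "pent i = pent j \<Longrightarrow> i = j"
proof -
  assume "pent i = pent j"
  hence "i * (3 * i + 1) = j * (3 * j + 1)" by (metis two_pent)
  hence "(i - j) * (3 * (i + j) + 1) = 0" by (simp add: algebra_simps)
  moreover have "3 * (i + j) + 1 \<noteq> 0" by presburger
  ultimately show "i = j" by simp
qed

text \<open>
  Since \<open>pent\<close> is injective the sum has at most one term; as a sum over a fibre it allows the
  partial sums over \<open>j\<close> and over \<open>m\<close> to be compared by regrouping.
\<close>
definition euler_coeff :: "nat \<Rightarrow> int" where
  "euler_coeff m = (\<Sum>j | pent j = m. (-1) ^ nat \<bar>j\<bar>)"

lemma pent_fibre: "(\<exists>j. {j. pent j = m} = {j}) \<or> {j. pent j = m} = {}"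
proof (cases "{j. pent j = m} = {}")
  case False
  then obtain i where "pent i = m" by blast
  hence "{j. pent j = m} = {i}" using pent_inj by blast
  thus ?thesis by blast
qed simp

lemma pent_le_iff: "pent j \<le> pent (int n) \<longleftrightarrow> j \<in> {-int n..int n}"
proof
  assume le: "pent j \<le> pent (int n)"
  hence "2 * int (pent j) \<le> 2 * int (pent (int n))" by simp
  hence "j * (3 * j + 1) \<le> int n * (3 * int n + 1)" unfolding two_pent .
  show "j \<in> {-int n..int n}"
  proof (rule ccontr)
    assume "j \<notin> {-int n..int n}"
    hence "int n + 1 \<le> \<bar>j\<bar>" by auto
    hence "(int n + 1) * (3 * (int n + 1) - 1) \<le> \<bar>j\<bar> * (3 * \<bar>j\<bar> - 1)"
      by (intro mult_mono) auto
    also have "\<dots> \<le> j * (3 * j + 1)" by (cases "j \<ge> 0") (auto simp: algebra_simps)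
    also have "\<dots> \<le> int n * (3 * int n + 1)" by fact
    finally show False by (simp add: algebra_simps)
  qed
next
  assume j: "j \<in> {-int n..int n}"
  have "j * (3 * j + 1) \<le> \<bar>j\<bar> * (3 * \<bar>j\<bar> + 1)" by (cases "j \<ge> 0") (auto simp: algebra_simps)
  also have "\<dots> \<le> int n * (3 * int n + 1)" using j by (intro mult_mono) auto
  finally have "2 * int (pent j) \<le> 2 * int (pent (int n))" unfolding two_pent .
  thus "pent j \<le> pent (int n)" by simp
qed

lemma euler_coeff_partial_sum:
  "(\<Sum>m\<le>pent (int n). of_int (euler_coeff m) * q ^ m) =
   (\<Sum>j=-int n..int n. (-1) ^ nat \<bar>j\<bar> * q ^ pent j)" for q :: complex
proof -
  have "(\<Sum>j=-int n..int n. (-1) ^ nat \<bar>j\<bar> * q ^ pent j) =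
      (\<Sum>m\<le>pent (int n). \<Sum>j | j \<in> {-int n..int n} \<and> pent j = m. (-1) ^ nat \<bar>j\<bar> * q ^ pent j)"
    by (rule sum.group[symmetric]) (use pent_le_iff in auto)
  also have "\<dots> = (\<Sum>m\<le>pent (int n). of_int (euler_coeff m) * q ^ m)"
  proof (rule sum.cong)
    fix m assume "m \<in> {..pent (int n)}"
    hence "{j \<in> {-int n..int n}. pent j = m} = {j. pent j = m}"
      using pent_le_iff by auto
    thus "(\<Sum>j | j \<in> {-int n..int n} \<and> pent j = m. (-1) ^ nat \<bar>j\<bar> * q ^ pent j) =
        of_int (euler_coeff m) * q ^ m"
      by (simp add: euler_coeff_def sum_distrib_right)
  qed auto
  finally show ?thesis ..
qed

lemma euler_coeff_sums:
  assumes q: "norm q < 1"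
  shows "(\<lambda>m. of_int (euler_coeff m) * q ^ m) sums qpoch_inf q q"
proof -
  have "norm (of_int (euler_coeff m) * q ^ m) \<le> norm q ^ m" for m
    using pent_fibre[of m] by (auto simp: euler_coeff_def norm_mult norm_power)
  hence sm: "summable (\<lambda>m. of_int (euler_coeff m) * q ^ m)"
    using q by (intro summable_comparison_test'[OF summable_geometric[of "norm q"]]) auto
  have "strict_mono (\<lambda>n. pent (int n))"
    by (rule strict_monoI_Suc, unfold pent_int) simp
  from LIMSEQ_subseq_LIMSEQ[OF summable_LIMSEQ'[OF sm] this]
  have "(\<lambda>n. \<Sum>j=-int n..int n. (-1) ^ nat \<bar>j\<bar> * q ^ pent j) \<longlonglongrightarrow>
      (\<Sum>m. of_int (euler_coeff m) * q ^ m)"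
    by (simp add: o_def euler_coeff_partial_sum)
  with pentagonal_LIMSEQ[OF q] have "qpoch_inf q q = (\<Sum>m. of_int (euler_coeff m) * q ^ m)"
    by (rule LIMSEQ_unique)
  thus ?thesis using sm by (simp add: sums_iff)
qed

section \<open>Reduction of the generating function modulo 2\<close>

definition euler_coeff_dilated :: "nat \<Rightarrow> nat \<Rightarrow> int" where
  "euler_coeff_dilated c n = (if c dvd n then euler_coeff (n div c) else 0)"

lemma euler_coeff_dilated_sums:
  assumes q: "norm q < 1" and c: "c > 0"
  shows "(\<lambda>n. of_int (euler_coeff_dilated c n) * q ^ n) sums qpoch_inf (q ^ c) (q ^ c)"
proof -
  have "norm (q ^ c) < 1" using q c by (simp add: norm_power power_less_one_iff)
  hence "(\<lambda>m. of_int (euler_coeff m) * (q ^ c) ^ m) sums qpoch_inf (q ^ c) (q ^ c)"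
    by (rule euler_coeff_sums)
  hence "(\<lambda>m. of_int (euler_coeff_dilated c (c * m)) * q ^ (c * m)) sums qpoch_inf (q ^ c) (q ^ c)"
    using c by (simp add: euler_coeff_dilated_def power_mult)
  thus ?thesis
    by (subst (asm) sums_mono_reindex) (use c in \<open>auto simp: strict_mono_def euler_coeff_dilated_def elim!: dvdE\<close>)
qed

text \<open>
  Completing the square: \<open>j (3 j + 1) / 2 = n\<close> if and only if \<open>(6 j + 1)\<^sup>2 = 24 n + 1\<close>.
\<close>
lemma of_int_euler_coeff_bit:
  "of_int (euler_coeff n) = (of_bool (\<exists>x. x mod 6 = 1 \<and> x ^ 2 = 24 * int n + 1) :: bit)"
proof -
  have pent_iff: "pent j = n \<longleftrightarrow> (6 * j + 1) ^ 2 = 24 * int n + 1" for j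
  proof -
    have "(6 * j + 1) ^ 2 = 12 * (2 * int (pent j)) + 1"
      unfolding two_pent by (simp add: power2_eq_square algebra_simps)
    thus ?thesis by auto
  qed
  have "(\<exists>x. x mod 6 = 1 \<and> x ^ 2 = 24 * int n + 1) \<longleftrightarrow> (\<exists>j. pent j = n)"
  proof
    assume "\<exists>x. x mod 6 = 1 \<and> x ^ 2 = 24 * int n + 1"
    then obtain x where x: "x mod 6 = 1" "x ^ 2 = 24 * int n + 1" by blast
    moreover obtain j where "x = 6 * j + 1" using x(1) by (metis mult_div_mod_eq)
    ultimately show "\<exists>j. pent j = n" using pent_iff by blast
  next
    assume "\<exists>j. pent j = n"
    then obtain j where "(6 * j + 1) ^ 2 = 24 * int n + 1" using pent_iff by blast
    moreover have "(6 * j + 1) mod 6 = 1" by presburger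
    ultimately show "\<exists>x. x mod 6 = 1 \<and> x ^ 2 = 24 * int n + 1" by blast
  qed
  moreover have "of_int (euler_coeff n) = (of_bool (\<exists>j. pent j = n) :: bit)"
    using pent_fibre[of n]
  proof (elim disjE exE)
    fix j assume j: "{j. pent j = n} = {j}"
    hence "\<exists>j. pent j = n" by blast
    thus ?thesis by (simp add: euler_coeff_def j)
  next
    assume e: "{j. pent j = n} = {}"
    hence "\<nexists>j. pent j = n" by blast
    thus ?thesis by (simp add: euler_coeff_def e)
  qed
  ultimately show ?thesis by simp
qed

lemma of_int_euler_coeff_dilated_bit:
  assumes c: "c > 0"
  shows "of_int (euler_coeff_dilated c n) = theta (int c) $ n"
proof (cases "c dvd n")
  case True
  then obtain m where n: "n = c * m" by blast
  have "int c * x ^ 2 = 24 * int n + int c \<longleftrightarrow> x ^ 2 = 24 * int m + 1" for x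
  proof -
    have "int c * x ^ 2 = 24 * int n + int c \<longleftrightarrow> int c * x ^ 2 = int c * (24 * int m + 1)"
      by (simp add: n algebra_simps)
    thus ?thesis using c by auto
  qed
  thus ?thesis
    using c by (simp add: euler_coeff_dilated_def n of_int_euler_coeff_bit theta_def)
next
  case False
  have "\<not> (x mod 6 = 1 \<and> int c * x ^ 2 = 24 * int n + int c)" for x
  proof
    assume x: "x mod 6 = 1 \<and> int c * x ^ 2 = 24 * int n + int c"
    then obtain k where "x ^ 2 = 24 * k + 1" using square_1_mod_6 by blast
    hence "int n = int c * k" using x by (simp add: algebra_simps)
    thus False using False by (metis dvd_triv_left int_dvd_int_iff)
  qed
  thus ?thesis using False by (simp add: euler_coeff_dilated_def theta_def)
qed

definition fps_of_int_fps :: "int fps \<Rightarrow> 'a :: comm_ring_1 fps" where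
  "fps_of_int_fps F = Abs_fps (\<lambda>n. of_int (F $ n))"

lemma fps_of_int_fps_mult: "fps_of_int_fps (F * G) = fps_of_int_fps F * fps_of_int_fps G"
  by (rule fps_ext) (simp add: fps_of_int_fps_def fps_mult_nth)

lemma fps_of_int_fps_power: "fps_of_int_fps (F ^ n) = fps_of_int_fps F ^ n"
proof (induction n)
  case 0
  show ?case by (rule fps_ext) (simp add: fps_of_int_fps_def)
qed (simp add: fps_of_int_fps_mult)

lemma fps_of_int_fps_eq_iff:
  "(fps_of_int_fps F :: 'a :: {comm_ring_1, ring_char_0} fps) = fps_of_int_fps G \<longleftrightarrow> F = G"
  by (auto simp: fps_of_int_fps_def fps_eq_iff)

lemma has_fps_expansion_of_int_sums:
  fixes f :: "complex \<Rightarrow> complex"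
  assumes "\<And>q. norm q < 1 \<Longrightarrow> (\<lambda>n. of_int (a n) * q ^ n) sums f q"
  shows "f has_fps_expansion fps_of_int_fps (Abs_fps a)"
proof (rule has_fps_expansionI)
  have "eventually (\<lambda>q::complex. q \<in> ball 0 1) (nhds 0)"
    by (intro eventually_nhds_in_open) auto
  thus "\<forall>\<^sub>F q in nhds 0. (\<lambda>n. fps_nth (fps_of_int_fps (Abs_fps a)) n * q ^ n) sums f q"
    by eventually_elim (use assms in \<open>auto simp: fps_of_int_fps_def\<close>)
qed

lemma qpoch_inf_minus_mult:
  assumes q: "norm q < 1" and m: "m > 0"
  shows "qpoch_inf (- (q ^ m)) (q ^ m) * qpoch_inf (q ^ m) (q ^ m) = qpoch_inf (q ^ (2 * m)) (q ^ (2 * m))"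
proof -
  have conv: "convergent_prod (\<lambda>j. 1 + q ^ m * (q ^ m) ^ j)" "convergent_prod (\<lambda>j. 1 - q ^ m * (q ^ m) ^ j)"
    using qpoch_inf_nonzero(2)[of "-1" m q] qpoch_inf_nonzero(2)[of 1 m q] q m by simp_all
  have sq: "q ^ (2 * m) = q ^ m * q ^ m" by (simp add: mult_2 power_add)
  from conv have "qpoch_inf (- (q ^ m)) (q ^ m) * qpoch_inf (q ^ m) (q ^ m) =
      (\<Prod>j. (1 + q ^ m * (q ^ m) ^ j) * (1 - q ^ m * (q ^ m) ^ j))"
    unfolding qpoch_inf_def by (simp add: prodinf_mult)
  also have "(\<lambda>j. (1 + q ^ m * (q ^ m) ^ j) * (1 - q ^ m * (q ^ m) ^ j)) =
      (\<lambda>j. 1 - q ^ (2 * m) * (q ^ (2 * m)) ^ j)"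
    by (rule ext) (simp only: sq power_mult_distrib, simp add: algebra_simps)
  finally show ?thesis unfolding qpoch_inf_def .
qed

text \<open>
  The generating function equals \<open>f\<^sub>2 f\<^sub>5 / (f\<^sub>1\<^sup>5 f\<^sub>1\<^sub>0)\<close>, by \<open>(-q\<^sup>m;q\<^sup>m) = f\<^bsub>2m\<^esub> / f\<^bsub>m\<^esub>\<close>. Clearing denominators
  leaves only series whose coefficients are known integers.
\<close>
lemma dots_bracelet_gf_5:
  assumes q: "norm q < 1"
  shows "dots_bracelet_gf 5 q * (qpoch_inf q q ^ 5 * qpoch_inf (q ^ 10) (q ^ 10)) =
         qpoch_inf (q ^ 2) (q ^ 2) * qpoch_inf (q ^ 5) (q ^ 5)"
proof -
  have nz: "qpoch_inf q q \<noteq> 0" "qpoch_inf (- (q ^ 5)) (q ^ 5) \<noteq> 0"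
    using qpoch_inf_nonzero(1)[of 1 1 q] qpoch_inf_nonzero(1)[of "-1" 5 q] q by simp_all
  have f2: "qpoch_inf (- q) q * qpoch_inf q q = qpoch_inf (q ^ 2) (q ^ 2)"
    and f10: "qpoch_inf (- (q ^ 5)) (q ^ 5) * qpoch_inf (q ^ 5) (q ^ 5) = qpoch_inf (q ^ 10) (q ^ 10)"
    using qpoch_inf_minus_mult[OF q, of 1] qpoch_inf_minus_mult[OF q, of 5] by simp_all
  have "qpoch_inf q q ^ 5 = qpoch_inf q q ^ 4 * qpoch_inf q q"
    by (simp add: power_Suc2[symmetric])
  thus ?thesis
    unfolding f2[symmetric] f10[symmetric] dots_bracelet_gf_def using nz by simp
qed

text \<open>
  The identity between analytic functions becomes one between integer power series, by
  uniqueness of expansions at 0, and can then be reduced modulo 2. There \<open>f\<^sub>2 = f\<^sub>1\<^sup>2\<close> and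
  \<open>f\<^sub>1\<^sub>0 = f\<^sub>5\<^sup>2\<close>, and the common factor \<open>f\<^sub>1\<^sup>2 f\<^sub>5\<close> cancels.
\<close>
lemma dots_bracelet_bit_fps:
  defines "B \<equiv> Abs_fps (\<lambda>n. of_int (dots_bracelet 5 n)) :: bit fps"
  shows "B * (theta 1 ^ 3 * theta 5) = 1"
proof -
  define E where "E = (\<lambda>c. Abs_fps (euler_coeff_dilated c))"
  define D where "D = Abs_fps (dots_bracelet 5)"
  have E: "(\<lambda>q. qpoch_inf (q ^ c) (q ^ c)) has_fps_expansion fps_of_int_fps (E c)" if "c > 0" for c
    unfolding E_def using euler_coeff_dilated_sums that by (intro has_fps_expansion_of_int_sums) auto
  have E1: "(\<lambda>q. qpoch_inf q q) has_fps_expansion fps_of_int_fps (E 1)"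
    using E[of 1] by simp
  have D: "dots_bracelet_gf 5 has_fps_expansion fps_of_int_fps D"
    unfolding D_def by (intro has_fps_expansion_of_int_sums dots_bracelet_sums) auto
  have lhs: "(\<lambda>q. dots_bracelet_gf 5 q * (qpoch_inf q q ^ 5 * qpoch_inf (q ^ 10) (q ^ 10)))
      has_fps_expansion fps_of_int_fps (D * (E 1 ^ 5 * E 10))"
    unfolding fps_of_int_fps_mult fps_of_int_fps_power
    by (intro has_fps_expansion_mult has_fps_expansion_power D E1 E) auto
  have rhs: "(\<lambda>q. qpoch_inf (q ^ 2) (q ^ 2) * qpoch_inf (q ^ 5) (q ^ 5))
      has_fps_expansion fps_of_int_fps (E 2 * E 5)"
    unfolding fps_of_int_fps_mult by (intro has_fps_expansion_mult E) auto
  have "eventually (\<lambda>q::complex. q \<in> ball 0 1) (nhds 0)"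
    by (intro eventually_nhds_in_open) auto
  hence ev: "\<forall>\<^sub>F q in nhds 0. dots_bracelet_gf 5 q * (qpoch_inf q q ^ 5 * qpoch_inf (q ^ 10) (q ^ 10)) =
      qpoch_inf (q ^ 2) (q ^ 2) * qpoch_inf (q ^ 5) (q ^ 5)"
    by eventually_elim (rule dots_bracelet_gf_5, simp)
  have "(\<lambda>q. qpoch_inf (q ^ 2) (q ^ 2) * qpoch_inf (q ^ 5) (q ^ 5))
      has_fps_expansion fps_of_int_fps (D * (E 1 ^ 5 * E 10))"
    using lhs by (rule has_fps_expansion_cong[OF ev refl, THEN iffD1])
  with rhs have "(fps_of_int_fps (D * (E 1 ^ 5 * E 10)) :: complex fps) = fps_of_int_fps (E 2 * E 5)"
    using fps_expansion_unique_complex by blast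
  hence "D * (E 1 ^ 5 * E 10) = E 2 * E 5"
    by (simp only: fps_of_int_fps_eq_iff)
  hence "(fps_of_int_fps (D * (E 1 ^ 5 * E 10)) :: bit fps) = fps_of_int_fps (E 2 * E 5)"
    by simp
  moreover have "fps_of_int_fps (E c) = theta (int c)" if "c > 0" for c
    by (rule fps_ext) (simp add: fps_of_int_fps_def E_def of_int_euler_coeff_dilated_bit that)
  from this[of 1] this[of 2] this[of 5] this[of 10]
  have "fps_of_int_fps (E 1) = theta 1" "fps_of_int_fps (E 2) = theta 1 ^ 2"
    "fps_of_int_fps (E 5) = theta 5" "fps_of_int_fps (E 10) = theta 5 ^ 2"
    using theta_power2[of 1] theta_power2[of 5] by simp_all
  moreover have "fps_of_int_fps D = B"
    by (simp add: fps_of_int_fps_def D_def B_def)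
  ultimately have eq: "B * (theta 1 ^ 5 * theta 5 ^ 2) = theta 1 ^ 2 * theta 5"
    by (simp only: fps_of_int_fps_mult fps_of_int_fps_power)
  have theta_nz: "theta c \<noteq> 0" for c
  proof -
    have "theta c $ 0 = 1" by (auto simp: theta_def intro!: exI[of _ 1])
    thus ?thesis by auto
  qed
  have "(theta 1 ^ 2 * theta 5) * (B * (theta 1 ^ 3 * theta 5)) = (theta 1 ^ 2 * theta 5) * 1"
    using eq by algebra
  thus ?thesis using theta_nz by simp
qed

lemma of_int_bit_eq_0_iff: "(of_int z :: bit) = 0 \<longleftrightarrow> even z"
  by (cases "even z") (auto elim!: evenE oddE)

lemma even_dots_bracelet:
  assumes "\<And>x y. x ^ 2 + 10 * y ^ 2 \<noteq> 24 * int m + 11"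
  shows "even (dots_bracelet 5 (8 * m + 4))"
proof -
  have "(theta 1 * theta 10) $ m = of_nat (card (theta_pairs 1 10 (24 * int m + 1 + 10)))"
    by (rule theta_mult_nth) simp_all
  also have "24 * int m + 1 + 10 = 24 * int m + 11" by simp
  also have "theta_pairs 1 10 (24 * int m + 11) = {}"
    using assms by (auto simp: theta_pairs_def)
  finally have "(theta 1 * theta 10) $ m = 0" by simp
  hence "of_int (dots_bracelet 5 (8 * m + 4)) = (0 :: bit)"
    using bracelet_series_coeff[OF dots_bracelet_bit_fps, of m] by simp
  thus ?thesis by (simp add: of_int_bit_eq_0_iff)
qed

text \<open>
  Every power of 25 has the form \<open>24 s + 1\<close>, so for \<open>c = 24 d + 11\<close> the index has the form \<open>8 m + 4\<close>
  with \<open>24 m + 11 = 25\<^bsup>k\<^esup> (24 e n + c)\<close>.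
\<close>
lemma dots_bracelet_cong_0:
  assumes c: "c = 24 * d + 11"
    and not_rep: "\<And>x y. x ^ 2 + 10 * y ^ 2 \<noteq> 25 ^ k * (24 * int (e * n) + int c)"
  shows "[dots_bracelet 5 (8 * (25 ^ k * (e * n)) + (c * 25 ^ k + 1) div 3) = 0] (mod 2)"
proof -
  have "(25 ^ k :: nat) mod 24 = 1"
    using power_mod[of "25 :: nat" 24 k] by simp
  then obtain s where s: "(25 ^ k :: nat) = 24 * s + 1" by (metis mult_div_mod_eq)
  define m where "m = 25 ^ k * (e * n) + c * s + d"
  have "c * 25 ^ k + 1 = 3 * (8 * (c * s + d) + 4)"
    by (simp add: s c algebra_simps)
  hence "8 * (25 ^ k * (e * n)) + (c * 25 ^ k + 1) div 3 = 8 * m + 4"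
    by (simp add: m_def)
  moreover have "24 * int m + 11 = 25 ^ k * (24 * int (e * n) + int c)"
  proof -
    have "24 * m + 11 = 25 ^ k * (24 * (e * n) + c)"
      unfolding m_def s using c by (simp add: algebra_simps)
    hence "int (24 * m + 11) = int (25 ^ k * (24 * (e * n) + c))" by (simp only:)
    thus ?thesis by simp
  qed
  ultimately show ?thesis
    using even_dots_bracelet[of m] not_rep by (simp add: cong_0_iff)
qed

section \<open>The four progressions\<close>
theorem theorem2p6:
  fixes \<alpha> n :: nat
  assumes "\<alpha> \<ge> 1"
  shows "[dots_bracelet 5 (8 * 5 ^ (2 * \<alpha>) * n + (31 * 5 ^ (2 * \<alpha> - 1) + 1) div 3) = 0] (mod 2)
       \<and> [dots_bracelet 5 (8 * 5 ^ (2 * \<alpha>) * n + (79 * 5 ^ (2 * \<alpha> - 1) + 1) div 3) = 0] (mod 2)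
       \<and> [dots_bracelet 5 (8 * 5 ^ (2 * \<alpha> + 1) * n + (83 * 5 ^ (2 * \<alpha>) + 1) div 3) = 0] (mod 2)
       \<and> [dots_bracelet 5 (8 * 5 ^ (2 * \<alpha> + 1) * n + (107 * 5 ^ (2 * \<alpha>) + 1) div 3) = 0] (mod 2)"
proof -
  obtain \<beta> where \<beta>: "\<alpha> = Suc \<beta>" using assms by (cases \<alpha>) auto
  have p: "5 ^ (2 * \<alpha>) = (25 ^ \<alpha> :: nat)" "5 ^ (2 * \<alpha> + 1) = (25 ^ \<alpha> * 5 :: nat)"
    "5 ^ (2 * \<alpha> - 1) = (5 * 25 ^ \<beta> :: nat)" "25 ^ \<alpha> = (25 ^ \<beta> * 25 :: nat)"
    by (simp_all add: \<beta> power_mult)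
  \<comment> \<open>One factor 5 moves from the odd power into the constants: \<open>155 = 5 \<cdot> 31\<close> and \<open>395 = 5 \<cdot> 79\<close>.\<close>
  have "[dots_bracelet 5 (8 * (25 ^ \<beta> * (25 * n)) + (155 * 25 ^ \<beta> + 1) div 3) = 0] (mod 2)"
  proof (rule dots_bracelet_cong_0[of _ 6])
    have "24 * int (25 * n) + int 155 = 5 * (120 * int n + 31)" by simp
    moreover have "(120 * int n + 31) mod 5 \<in> {1, 4}" by (simp, presburger)
    ultimately show "x ^ 2 + 10 * y ^ 2 \<noteq> 25 ^ \<beta> * (24 * int (25 * n) + int 155)" for x y
      using form_1_10_not_rep(2) by metis
  qed simp
  moreover have "[dots_bracelet 5 (8 * (25 ^ \<beta> * (25 * n)) + (395 * 25 ^ \<beta> + 1) div 3) = 0] (mod 2)"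
  proof (rule dots_bracelet_cong_0[of _ 16])
    have "24 * int (25 * n) + int 395 = 5 * (120 * int n + 79)" by simp
    moreover have "(120 * int n + 79) mod 5 \<in> {1, 4}" by (simp, presburger)
    ultimately show "x ^ 2 + 10 * y ^ 2 \<noteq> 25 ^ \<beta> * (24 * int (25 * n) + int 395)" for x y
      using form_1_10_not_rep(2) by metis
  qed simp
  moreover have "[dots_bracelet 5 (8 * (25 ^ \<alpha> * (5 * n)) + (83 * 25 ^ \<alpha> + 1) div 3) = 0] (mod 2)"
  proof (rule dots_bracelet_cong_0[of _ 3])
    have "(24 * int (5 * n) + int 83) mod 5 \<in> {2, 3}" by (simp, presburger)
    thus "x ^ 2 + 10 * y ^ 2 \<noteq> 25 ^ \<alpha> * (24 * int (5 * n) + int 83)" for x y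
      by (rule form_1_10_not_rep(1))
  qed simp
  moreover have "[dots_bracelet 5 (8 * (25 ^ \<alpha> * (5 * n)) + (107 * 25 ^ \<alpha> + 1) div 3) = 0] (mod 2)"
  proof (rule dots_bracelet_cong_0[of _ 4])
    have "(24 * int (5 * n) + int 107) mod 5 \<in> {2, 3}" by (simp, presburger)
    thus "x ^ 2 + 10 * y ^ 2 \<noteq> 25 ^ \<alpha> * (24 * int (5 * n) + int 107)" for x y
      by (rule form_1_10_not_rep(1))
  qed simp
  moreover have "31 * (5 * 25 ^ \<beta>) = (155 * 25 ^ \<beta> :: nat)" "79 * (5 * 25 ^ \<beta>) = (395 * 25 ^ \<beta> :: nat)"
    "8 * (25 ^ \<beta> * 25) * n = 8 * (25 ^ \<beta> * (25 * n))" "8 * (25 ^ \<alpha> * 5) * n = 8 * (25 ^ \<alpha> * (5 * n))"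
    by simp_all
  ultimately show ?thesis
    unfolding p(1-3) by (simp only: p(4))
qed

end
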